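(* In the run setting described in the context, for every $i\le n$ and all terms $a,b$, if $\sigma(T_i;E_i)\vdash_{eq}a\doteq b$, then there is a typed normal proof of $\sigma(T_i;E_i)\vdash a\doteq b$.
   Context: Terms. Fix disjoint sets $\mathscr N$ of names and $\mathscr V$ of variables; $\mathscr V$ contains a subset $\mathscr V_q$ of quantified variables. Terms: $t::=x\mid m\mid\mathsf f(t_1,\dots,t_n)$ ($x\in\mathscr V$, $m\in\mathscr N$, $\mathsf f$ an $n$-ary operator, including $\mathit{pk}$). $\mathsf{st}$ denotes subterms. Substitutions are finite partial maps from variables to terms; $\lambda\lambda'$ applies $\lambda'$ first. Term derivability $X\vdash_{dy}t$: axiom rule, constructor rules (from $X\vdash t_1,\dots,X\vdash t_n$ infer $X\vdash\mathsf f(t_1,\dots,t_n)$), destructor rules (from $X\vdash\mathsf f(t_1,\dots,t_n)$, the major premise, and $X\vdash u_1,\dots,X\vdash u_m$ infer $X\vdash t_i$), the axiom counting as destructor; normal = no constructor conclusion is a major premise of a destructor; assumed: normalization, subterm property (normal proofs of $X\vdash t$ use only terms in $\mathsf{st}(X\cup\{t\})$, only $\mathsf{st}(X)$ if ending in a destructor), polynomial-time decidability. Positions: $\mathrm{pos}(t)$, $t|_p$, $\mathrm{pos}_r(t)$, $t[P\mapsto r]$ as usual; $\mathbb A(S,t)=\{p\in\mathrm{pos}(t):S\vdash_{dy}t|_q\ \forall q\in Q_p\}$ with $Q_p=\{\varepsilon\}\cup\{qi\in\mathrm{pos}(t): q\text{ a proper prefix of }p\}$. Assertions: $\alpha::=t\doteq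 u\mid P(u_1,\dots,u_m)\mid t_0\twoheadleftarrow[t_1,\dots,t_n]\mid\alpha_0\wedge\alpha_1\mid\exists x.\alpha\mid\mathit{pk}(k)\ \mathit{says}\ \alpha$ ($u_i,t_0\in\mathscr N\cup\mathscr V$, $t_j\in\mathscr N$, $x\in\mathscr V_q$); atomic = not a conjunction or existential; $\mathrm{fv},\mathrm{bv}$; $\mathsf{pubs}(\alpha)$ = maximal subterms with no variable of $\mathscr V_q$. Term positions: $\mathrm{pos}(t\doteq t')=0\cdot\mathrm{pos}(t)\cup1\cdot\mathrm{pos}(t')$; $\mathrm{pos}(P(u_0..u_m))=\{0..m\}$; $\mathrm{pos}(t\twoheadleftarrow[t_1..t_n])=\{0..n\}$; $\mathrm{pos}(\alpha\wedge\beta)=0\cdot\mathrm{pos}(\alpha)\cup1\cdot\mathrm{pos}(\beta)$; $\mathrm{pos}(\exists x.\alpha)=0\cdot\mathrm{pos}(\alpha)$; $\mathrm{pos}(\mathit{pk}(k)\ \mathit{says}\ \alpha)=\{0,00\}\cup1\cdot\mathrm{pos}(\alpha)$. Abstractable positions: $\mathbb A(S,t_0\doteq t_1)=\{ip:p\in\mathbb A(S,t_i)\}$; $\mathbb A(S,P(\vec u))=\{i:S\vdash_{dy}u_i\}$; $\mathbb A(S,t\twoheadleftarrow[\dots])=\{0\}$; $\mathbb A(S,\alpha_0\wedge\alpha_1)=\{ip:p\in\mathbb A(S,\alpha_i)\}$; $\mathbb A(S,\exists x.\alpha)=\{0p:p\in\mathbb A(S\cup\{x\},\alpha)\}$; $\mathbb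 A(S,\mathit{pk}(k)\ \mathit{says}\ \alpha)=\{0\}\cup\{1p:p\in\mathbb A(S,\alpha)\}$. Assertion derivability $S;A\vdash_a\alpha$: (ax) $S;A\cup\{\alpha\}\vdash\alpha$; (eq) from $S\vdash_{dy}t$ infer $t\doteq t$; (cons) from $t_j\doteq u_j$ ($j\le r$) infer $\mathsf f(\vec t)\doteq\mathsf f(\vec u)$; (sym); (trans) from $t_1\doteq t_2,\dots,t_k\doteq t_{k+1}$ infer $t_1\doteq t_{k+1}$; (proj$_i$) from $\mathsf f(t_1..t_r)\doteq\mathsf f(u_1..u_r)$ infer $t_i\doteq u_i$ provided the positions of all $t_j,u_j$ are abstractable in that assertion w.r.t. $S$; ($\wedge$I); ($\wedge$E$_i$); (subst) from $t\twoheadleftarrow l$, $t\doteq u$ infer $u\twoheadleftarrow l$; ($\exists$I) from $\alpha[P\mapsto t]$ and $S\vdash_{dy}t$ infer $\exists x.\alpha$, $P=\mathrm{pos}_x(\alpha)\subseteq\mathbb A(S\cup\{x\},\alpha)$; ($\exists$E) from $S;A\vdash\exists x.\alpha$ and $S\cup\{y\};A\cup\{\alpha[P\mapsto y]\}\vdash\gamma$ infer $S;A\vdash\gamma$, $y$ fresh, $P=\mathrm{pos}_x(\alpha)$; (say) from $\alpha$ and $S\vdash_{dy}k$ infer $\mathit{pk}(k)\ \mathit{says}\ \alpha$; (prom) from $t\twoheadleftarrow[n]$ infer $t\doteq n$; (int) from $t\twoheadleftarrow l_1,\dots,t\twoheadleftarrow l_m$ infer $t\twoheadleftarrow\bigcap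 l_j$; (wk) from $t\doteq n_i$ and $S\vdash_{dy}n_j$ for all $j$ infer $t\twoheadleftarrow[n_1..n_k]$. $\vdash_{eq}$: without $\wedge$I, $\wedge$E, $\exists$I, $\exists$E, say. Kernel: $\mathit{ker}(S;A)=(S\cup\mathrm{bv}(A);\bigcup_{\alpha\in A}\mathsf{at}(\alpha))$, $\mathsf{at}(\alpha)$ = maximal atomic subformulas. $\mathsf{hat}$: $\mathsf{hat}(\alpha\wedge\beta)=\mathsf{hat}(\alpha)\cup\mathsf{hat}(\beta)$, $\mathsf{hat}(\exists x.\alpha)=\mathsf{hat}(\alpha)$, $\mathsf{hat}(\mathit{pk}(k)\ \mathit{says}\ \alpha)=\{\mathit{pk}(k)\ \mathit{says}\ \alpha\}\cup\mathsf{hat}(\alpha)$, otherwise $\{\gamma\}$. Normal $\vdash_{eq}$ proofs (for atomic LHS and conclusion): say $\mathsf r_1$ precedes $\mathsf r_2$ if a conclusion of $\mathsf r_1$ is a premise of $\mathsf r_2$; a proof is normal if all its $\vdash_{dy}$ subproofs are normal; sym is preceded only by ax or prom; eq is preceded only by a destructor rule; no premise of trans is of the form $a\doteq a$ or a conclusion of trans; adjacent premises of trans are not both conclusions of cons; int is not preceded by int or wk; no subproof ending in proj contains cons. Protocols and runs. Agents $\mathscr A\subseteq\mathscr N$ include the intruder $I$. A protocol is a finite set of roles $(\beta_1,\alpha_1)\cdots(\beta_m,\alpha_m)$; agent variables are free variables first occurring in some $\alpha_j$. A session is $u:(\beta_1\Rightarrow\alpha_1)\cdots u:(\beta_\ell\Rightarrow\alpha_\ell)$,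 $u\in\mathscr A$, a role prefix with agent variables instantiated by names; coherent sets of sessions share no free variables. $\mathit{update}((X;\Phi),\alpha)=(X\cup\mathsf{pubs}(\alpha);\Phi\cup\{\alpha\})$. Run setting: fix a run $(\xi,\sigma)$: $\xi=u_1:(\beta_1\Rightarrow\alpha_1),\dots,u_n:(\beta_n\Rightarrow\alpha_n)$ an interleaving of a finite coherent set of sessions, $\sigma$ a ground substitution with domain the free variables of $\xi$, with knowledge functions $\mathsf k_0,\dots,\mathsf k_n$: $\mathsf k_0(a)=(X_a;\emptyset)$, and for $1\le i\le n$, $\mathsf k_i(a)=\mathsf k_{i-1}(a)$ for $a\notin\{u_i,I\}$, $\mathsf k_i(u_i)=\mathit{update}(\mathsf k_{i-1}(u_i),\beta_i)$, $\mathsf k_i(I)=\mathit{update}(\mathsf k_{i-1}(I),\alpha_i)$, with $\mathsf k_i(u_i)\vdash_a\alpha_i$ and $\sigma(\mathsf k_{i-1}(I))\vdash_a\sigma(\beta_i)$. Variables are renamed so that the free variables of $\xi$ are not in $\mathscr V_q$, no variable occurs both free and bound, and none is bound twice. $(T_i;E_i)=\mathit{ker}(\mathsf k_i(I))$, $(U_i;F_i)=\mathit{ker}(\mathsf k_i(u_i))$. For each $1\le i\le n$ fix $X_i\subseteq\mathsf{hat}(\beta_i)$ and $\mu_i$ with domain $\mathrm{bv}(\beta_i)\setminus\mathrm{bv}(X_i)$ such that $\sigma(T_{i-1})\vdash_{dy}\mu_i(x)$ for $x\in\mathrm{dom}(\mu_i)$ and $\sigma(T_{i-1};E_{i-1})\vdash_{eq}\sigma\mu_i(\gamma)$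 for $\gamma\in X_i$; and $Y_i\subseteq\mathsf{hat}(\alpha_i)$, $\theta_i$ with domain $\mathrm{bv}(\alpha_i)\setminus\mathrm{bv}(Y_i)$ such that $\sigma(U_i)\vdash_{dy}\theta_i(x)$ and $\sigma(U_i;F_i)\vdash_{eq}\sigma\theta_i(\gamma)$ for $\gamma\in Y_i$. $\omega=\sigma\mu_1\theta_1\cdots\mu_n\theta_n$. $\mathscr C=\bigcup_{i\le n}(\mathsf{st}(T_i\cup U_i)\cup\mathsf{st}(E_i\cup F_i))$, $\mathscr D=\mathscr C\setminus\mathscr V$. A term is typed if it lies in $\sigma(\mathscr D)\cup\omega(\mathscr C)\cup\mathscr V_q$. Typed $\vdash_{eq}$ proof: a proof of $X;A\vdash r\doteq s$ is typed if for every subproof with conclusion $t\doteq u$, either that subproof contains an application of cons, or $t=u$, or both $t$ and $u$ are typed terms.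
   Formalization: Added: X_i (Y_i) must suffice to rebuild β_i (α_i) by introducing ∧, ∃ and says; without this (e.g. X_i=Y_i=∅) the claim fails. Initial knowledge X_a is assumed to contain no quantified variables. *)

theory Defs
  imports Main
begin

section \<open>Terms and substitutions\<close>

datatype (ops: 'f, names: 'n, vars: 'v) trm =
  Var 'v | Name 'n | Fun 'f "('f, 'n, 'v) trm list"

primrec tsubst :: "('w \<Rightarrow> ('f, 'n, 'v) trm) \<Rightarrow> ('f, 'n, 'w) trm \<Rightarrow> ('f, 'n, 'v) trm" where
  "tsubst s (Var x) = s x"
| "tsubst s (Name m) = Name m"
| "tsubst s (Fun f ts) = Fun f (map (tsubst s) ts)"

type_synonym ('f, 'n, 'v) sub = "'v \<Rightarrow> ('f, 'n, 'v) trm option"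

definition app :: "('f, 'n, 'v) sub \<Rightarrow> ('f, 'n, 'v) trm \<Rightarrow> ('f, 'n, 'v) trm" where
  "app \<tau> = tsubst (\<lambda>x. case \<tau> x of None \<Rightarrow> Var x | Some t \<Rightarrow> t)"

text \<open>The composition applies its second argument first.\<close>

definition scomp :: "('f, 'n, 'v) sub \<Rightarrow> ('f, 'n, 'v) sub \<Rightarrow> ('f, 'n, 'v) sub" where
  "scomp \<tau> \<tau>' = (\<lambda>x. case \<tau>' x of Some t \<Rightarrow> Some (app \<tau> t) | None \<Rightarrow> \<tau> x)"

primrec st :: "('f, 'n, 'v) trm \<Rightarrow> ('f, 'n, 'v) trm set" where
  "st (Var x) = {Var x}"
| "st (Name m) = {Name m}"
| "st (Fun f ts) = insert (Fun f ts) (\<Union> (set (map st ts)))"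

text \<open>Positions are lists of argument indices counted from 0; the option encodes
  whether a list is a position of the term.\<close>

fun at_pos :: "('f, 'n, 'v) trm \<Rightarrow> nat list \<Rightarrow> ('f, 'n, 'v) trm option" where
  "at_pos t [] = Some t"
| "at_pos (Fun f ts) (i # p) = (if i < length ts then at_pos (ts ! i) p else None)"
| "at_pos _ (i # p) = None"

definition pos :: "('f, 'n, 'v) trm \<Rightarrow> nat list set" where
  "pos t = {p. at_pos t p \<noteq> None}"

definition pos_of :: "('f, 'n, 'v) trm \<Rightarrow> ('f, 'n, 'v) trm \<Rightarrow> nat list set" where
  "pos_of r t = {p. at_pos t p = Some r}"

lemma size_nth_termination [termination_simp]:
  "i < length ts \<Longrightarrow> size (ts ! i) < Suc (size_list size ts)"
  by (meson le_imp_less_Suc nth_mem order_refl size_list_estimation')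

fun trepl :: "('f, 'n, 'v) trm \<Rightarrow> nat list set \<Rightarrow> ('f, 'n, 'v) trm \<Rightarrow> ('f, 'n, 'v) trm" where
  "trepl (Var x) P r = (if [] \<in> P then r else Var x)"
| "trepl (Name m) P r = (if [] \<in> P then r else Name m)"
| "trepl (Fun f ts) P r = (if [] \<in> P then r
     else Fun f (map (\<lambda>i. trepl (ts ! i) {p. i # p \<in> P} r) [0..<length ts]))"


section \<open>The ambient system and term derivability\<close>

text \<open>A destructor rule \<open>(f, ls, us, i)\<close> is a scheme over metavariables of type \<open>nat\<close>:
  from the major premise \<open>f(ls)\<close> and the minor premises \<open>us\<close> infer \<open>ls ! i\<close>.\<close>

type_synonym ('f, 'n) drule =
  "'f \<times> ('f, 'n, nat) trm list \<times> ('f, 'n, nat) trm list \<times> nat"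

record ('f, 'n, 'v) sys =
  ar :: "'f \<Rightarrow> nat"
  pk :: 'f
  destr :: "('f, 'n) drule set"
  qvars :: "'v set"
  agents :: "'n set"
  intruder :: 'n

primrec wf_trm :: "('f \<Rightarrow> nat) \<Rightarrow> ('f, 'n, 'v) trm \<Rightarrow> bool" where
  "wf_trm a (Var x) = True"
| "wf_trm a (Name m) = True"
| "wf_trm a (Fun f ts) = (length ts = a f \<and> list_all (wf_trm a) ts)"

datatype ('f, 'n, 'v) dyp =
  DAx "('f, 'n, 'v) trm"
| DCon 'f "('f, 'n, 'v) dyp list"
| DDes "('f, 'n, 'v) trm" "('f, 'n, 'v) dyp" "('f, 'n, 'v) dyp list"

primrec dconcl :: "('f, 'n, 'v) dyp \<Rightarrow> ('f, 'n, 'v) trm" where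
  "dconcl (DAx t) = t"
| "dconcl (DCon f ds) = Fun f (map dconcl ds)"
| "dconcl (DDes t d ds) = t"

primrec dproof :: "('f, 'n, 'v) sys \<Rightarrow> ('f, 'n, 'v) trm set \<Rightarrow> ('f, 'n, 'v) dyp \<Rightarrow> bool" where
  "dproof Sg X (DAx t) = (t \<in> X)"
| "dproof Sg X (DCon f ds) = (length ds = ar Sg f \<and> list_all (dproof Sg X) ds)"
| "dproof Sg X (DDes t d ds) =
     (dproof Sg X d \<and> list_all (dproof Sg X) ds \<and>
      (\<exists>f ls us i s. (f, ls, us, i) \<in> destr Sg \<and>
         dconcl d = Fun f (map (tsubst s) ls) \<and>
         map dconcl ds = map (tsubst s) us \<and> t = tsubst s (ls ! i)))"

definition dy :: "('f, 'n, 'v) sys \<Rightarrow> ('f, 'n, 'v) trm set \<Rightarrow> ('f, 'n, 'v) trm \<Rightarrow> bool" where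
  "dy Sg X t \<longleftrightarrow> (\<exists>d. dproof Sg X d \<and> dconcl d = t)"

primrec dterms :: "('f, 'n, 'v) dyp \<Rightarrow> ('f, 'n, 'v) trm set" where
  "dterms (DAx t) = {t}"
| "dterms (DCon f ds) = insert (Fun f (map dconcl ds)) (\<Union> (set (map dterms ds)))"
| "dterms (DDes t d ds) = insert t (dterms d \<union> \<Union> (set (map dterms ds)))"

text \<open>The axiom rule counts as a destructor.\<close>

fun ends_destr :: "('f, 'n, 'v) dyp \<Rightarrow> bool" where
  "ends_destr (DCon f ds) = False"
| "ends_destr _ = True"

primrec dnormal :: "('f, 'n, 'v) dyp \<Rightarrow> bool" where
  "dnormal (DAx t) = True"
| "dnormal (DCon f ds) = list_all dnormal ds"
| "dnormal (DDes t d ds) = (ends_destr d \<and> dnormal d \<and> list_all dnormal ds)"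

definition dy_system :: "('f, 'n, 'v) sys \<Rightarrow> bool" where
  "dy_system Sg \<longleftrightarrow>
     ar Sg (pk Sg) = 1 \<and> intruder Sg \<in> agents Sg \<and>
     (\<forall>(f, ls, us, i) \<in> destr Sg. length ls = ar Sg f \<and> i < length ls \<and>
        list_all (wf_trm (ar Sg)) ls \<and> list_all (wf_trm (ar Sg)) us) \<and>
     (\<forall>X t. (\<forall>s\<in>X. wf_trm (ar Sg) s) \<longrightarrow> dy Sg X t \<longrightarrow>
        (\<exists>d. dproof Sg X d \<and> dconcl d = t \<and> dnormal d)) \<and>
     (\<forall>X d. (\<forall>s\<in>X. wf_trm (ar Sg) s) \<longrightarrow> dproof Sg X d \<longrightarrow> dnormal d \<longrightarrow>
        dterms d \<subseteq> (\<Union>s\<in>insert (dconcl d) X. st s) \<and>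
        (ends_destr d \<longrightarrow> dterms d \<subseteq> (\<Union>s\<in>X. st s)))"

text \<open>Abstractable positions of a term; the inner set is \<open>Q\<^sub>p\<close>.\<close>

definition tabs :: "('f, 'n, 'v) sys \<Rightarrow> ('f, 'n, 'v) trm set \<Rightarrow> ('f, 'n, 'v) trm \<Rightarrow> nat list set" where
  "tabs Sg S t = {p \<in> pos t.
     \<forall>q \<in> {[]} \<union> {q @ [i] | q i. q @ [i] \<in> pos t \<and> (\<exists>r. r \<noteq> [] \<and> p = q @ r)}.
       dy Sg S (the (at_pos t q))}"


section \<open>Assertions\<close>

text \<open>\<open>AMem t l\<close> is membership of \<open>t\<close> in a list of names, and \<open>ASays k \<alpha>\<close> is
  \<open>pk(k) says \<alpha>\<close>. The arguments of predicates and the left-hand side of memberships are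
  arbitrary terms here, because substitutions are applied to assertions; the grammar is
  enforced by \<open>wf_asrt\<close>.\<close>

datatype ('p, 'f, 'n, 'v) asrt =
  AEq "('f, 'n, 'v) trm" "('f, 'n, 'v) trm"
| APred 'p "('f, 'n, 'v) trm list"
| AMem "('f, 'n, 'v) trm" "'n list"
| AAnd "('p, 'f, 'n, 'v) asrt" "('p, 'f, 'n, 'v) asrt"
| AEx 'v "('p, 'f, 'n, 'v) asrt"
| ASays "('f, 'n, 'v) trm" "('p, 'f, 'n, 'v) asrt"

fun atomic_trm :: "('f, 'n, 'v) trm \<Rightarrow> bool" where
  "atomic_trm (Fun f ts) = False"
| "atomic_trm _ = True"

primrec wf_asrt :: "('f, 'n, 'v) sys \<Rightarrow> ('p, 'f, 'n, 'v) asrt \<Rightarrow> bool" where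
  "wf_asrt Sg (AEq t u) = (wf_trm (ar Sg) t \<and> wf_trm (ar Sg) u)"
| "wf_asrt Sg (APred P us) = list_all atomic_trm us"
| "wf_asrt Sg (AMem t l) = atomic_trm t"
| "wf_asrt Sg (AAnd \<alpha> \<beta>) = (wf_asrt Sg \<alpha> \<and> wf_asrt Sg \<beta>)"
| "wf_asrt Sg (AEx x \<alpha>) = (x \<in> qvars Sg \<and> wf_asrt Sg \<alpha>)"
| "wf_asrt Sg (ASays k \<alpha>) = (wf_trm (ar Sg) k \<and> wf_asrt Sg \<alpha>)"

primrec fv :: "('p, 'f, 'n, 'v) asrt \<Rightarrow> 'v set" where
  "fv (AEq t u) = vars t \<union> vars u"
| "fv (APred P us) = (\<Union>u\<in>set us. vars u)"
| "fv (AMem t l) = vars t"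
| "fv (AAnd \<alpha> \<beta>) = fv \<alpha> \<union> fv \<beta>"
| "fv (AEx x \<alpha>) = fv \<alpha> - {x}"
| "fv (ASays k \<alpha>) = vars k \<union> fv \<alpha>"

text \<open>The list of binders, with multiplicity.\<close>

primrec binders :: "('p, 'f, 'n, 'v) asrt \<Rightarrow> 'v list" where
  "binders (AEq t u) = []"
| "binders (APred P us) = []"
| "binders (AMem t l) = []"
| "binders (AAnd \<alpha> \<beta>) = binders \<alpha> @ binders \<beta>"
| "binders (AEx x \<alpha>) = x # binders \<alpha>"
| "binders (ASays k \<alpha>) = binders \<alpha>"

definition bv :: "('p, 'f, 'n, 'v) asrt \<Rightarrow> 'v set" where
  "bv \<alpha> = set (binders \<alpha>)"

primrec asub :: "('f, 'n, 'v) sub \<Rightarrow> ('p, 'f, 'n, 'v) asrt \<Rightarrow> ('p, 'f, 'n, 'v) asrt" where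
  "asub \<tau> (AEq t u) = AEq (app \<tau> t) (app \<tau> u)"
| "asub \<tau> (APred P us) = APred P (map (app \<tau>) us)"
| "asub \<tau> (AMem t l) = AMem (app \<tau> t) l"
| "asub \<tau> (AAnd \<alpha> \<beta>) = AAnd (asub \<tau> \<alpha>) (asub \<tau> \<beta>)"
| "asub \<tau> (AEx x \<alpha>) = AEx x (asub (\<tau>(x := None)) \<alpha>)"
| "asub \<tau> (ASays k \<alpha>) = ASays (app \<tau> k) (asub \<tau> \<alpha>)"

text \<open>Renaming of bound variables.\<close>

inductive alpha :: "('p, 'f, 'n, 'v) asrt \<Rightarrow> ('p, 'f, 'n, 'v) asrt \<Rightarrow> bool" where
  alpha_refl: "alpha \<alpha> \<alpha>"
| alpha_sym: "alpha \<alpha> \<beta> \<Longrightarrow> alpha \<beta> \<alpha>"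
| alpha_trans: "alpha \<alpha> \<beta> \<Longrightarrow> alpha \<beta> \<gamma> \<Longrightarrow> alpha \<alpha> \<gamma>"
| alpha_ren: "y \<notin> fv \<alpha> \<union> bv \<alpha> \<Longrightarrow> alpha (AEx x \<alpha>) (AEx y (asub [x \<mapsto> Var y] \<alpha>))"
| alpha_and: "alpha \<alpha> \<alpha>' \<Longrightarrow> alpha \<beta> \<beta>' \<Longrightarrow> alpha (AAnd \<alpha> \<beta>) (AAnd \<alpha>' \<beta>')"
| alpha_ex: "alpha \<alpha> \<alpha>' \<Longrightarrow> alpha (AEx x \<alpha>) (AEx x \<alpha>')"
| alpha_says: "alpha \<alpha> \<alpha>' \<Longrightarrow> alpha (ASays k \<alpha>) (ASays k \<alpha>')"

primrec ast :: "('f, 'n, 'v) sys \<Rightarrow> ('p, 'f, 'n, 'v) asrt \<Rightarrow> ('f, 'n, 'v) trm set" where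
  "ast Sg (AEq t u) = st t \<union> st u"
| "ast Sg (APred P us) = (\<Union>u\<in>set us. st u)"
| "ast Sg (AMem t l) = st t \<union> Name ` set l"
| "ast Sg (AAnd \<alpha> \<beta>) = ast Sg \<alpha> \<union> ast Sg \<beta>"
| "ast Sg (AEx x \<alpha>) = ast Sg \<alpha>"
| "ast Sg (ASays k \<alpha>) = st (Fun (pk Sg) [k]) \<union> ast Sg \<alpha>"

text \<open>Maximality of public subterms refers to occurrences: a public term occurring on its own
  is collected even if it is also a subterm of another public term.\<close>

fun tpubs :: "'v set \<Rightarrow> ('f, 'n, 'v) trm \<Rightarrow> ('f, 'n, 'v) trm set" where
  "tpubs V (Var x) = (if x \<in> V then {} else {Var x})"
| "tpubs V (Name m) = {Name m}"
| "tpubs V (Fun f ts) = (if vars (Fun f ts) \<inter> V = {} then {Fun f ts}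
     else (\<Union>t\<in>set ts. tpubs V t))"

primrec pubs :: "('f, 'n, 'v) sys \<Rightarrow> ('p, 'f, 'n, 'v) asrt \<Rightarrow> ('f, 'n, 'v) trm set" where
  "pubs Sg (AEq t u) = tpubs (qvars Sg) t \<union> tpubs (qvars Sg) u"
| "pubs Sg (APred P us) = (\<Union>u\<in>set us. tpubs (qvars Sg) u)"
| "pubs Sg (AMem t l) = tpubs (qvars Sg) t \<union> Name ` set l"
| "pubs Sg (AAnd \<alpha> \<beta>) = pubs Sg \<alpha> \<union> pubs Sg \<beta>"
| "pubs Sg (AEx x \<alpha>) = pubs Sg \<alpha>"
| "pubs Sg (ASays k \<alpha>) = tpubs (qvars Sg) (Fun (pk Sg) [k]) \<union> pubs Sg \<alpha>"

text \<open>Positions of the free occurrences of a variable; in \<open>pk(k) says \<alpha>\<close> the positions are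
  0 for \<open>pk(k)\<close>, 00 for \<open>k\<close> and those of \<open>\<alpha>\<close> prefixed by 1.\<close>

primrec vpos :: "'v \<Rightarrow> ('p, 'f, 'n, 'v) asrt \<Rightarrow> nat list set" where
  "vpos x (AEq t u) = (#) 0 ` pos_of (Var x) t \<union> (#) 1 ` pos_of (Var x) u"
| "vpos x (APred P us) = {[i] | i. i < length us \<and> us ! i = Var x}"
| "vpos x (AMem t l) = (if t = Var x then {[0]} else {})"
| "vpos x (AAnd \<alpha> \<beta>) = (#) 0 ` vpos x \<alpha> \<union> (#) 1 ` vpos x \<beta>"
| "vpos x (AEx y \<alpha>) = (if x = y then {} else (#) 0 ` vpos x \<alpha>)"
| "vpos x (ASays k \<alpha>) = (if k = Var x then {[0, 0]} else {}) \<union> (#) 1 ` vpos x \<alpha>"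

text \<open>Only used for sets of positions of variables, so the list of names in a membership and
  the position 0 of a says-assertion are never affected.\<close>

primrec arepl :: "('p, 'f, 'n, 'v) asrt \<Rightarrow> nat list set \<Rightarrow> ('f, 'n, 'v) trm \<Rightarrow> ('p, 'f, 'n, 'v) asrt" where
  "arepl (AEq t u) P r = AEq (trepl t {p. 0 # p \<in> P} r) (trepl u {p. 1 # p \<in> P} r)"
| "arepl (APred Q us) P r = APred Q (map (\<lambda>i. if [i] \<in> P then r else us ! i) [0..<length us])"
| "arepl (AMem t l) P r = AMem (if [0] \<in> P then r else t) l"
| "arepl (AAnd \<alpha> \<beta>) P r = AAnd (arepl \<alpha> {p. 0 # p \<in> P} r) (arepl \<beta> {p. 1 # p \<in> P} r)"
| "arepl (AEx x \<alpha>) P r = AEx x (arepl \<alpha> {p. 0 # p \<in> P} r)"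
| "arepl (ASays k \<alpha>) P r = ASays (if [0, 0] \<in> P then r else k) (arepl \<alpha> {p. 1 # p \<in> P} r)"

primrec aabs :: "('f, 'n, 'v) sys \<Rightarrow> ('p, 'f, 'n, 'v) asrt \<Rightarrow> ('f, 'n, 'v) trm set \<Rightarrow> nat list set" where
  "aabs Sg (AEq t u) S = (#) 0 ` tabs Sg S t \<union> (#) 1 ` tabs Sg S u"
| "aabs Sg (APred P us) S = {[i] | i. i < length us \<and> dy Sg S (us ! i)}"
| "aabs Sg (AMem t l) S = {[0]}"
| "aabs Sg (AAnd \<alpha> \<beta>) S = (#) 0 ` aabs Sg \<alpha> S \<union> (#) 1 ` aabs Sg \<beta> S"
| "aabs Sg (AEx x \<alpha>) S = (#) 0 ` aabs Sg \<alpha> (insert (Var x) S)"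
| "aabs Sg (ASays k \<alpha>) S = {[0]} \<union> (#) 1 ` aabs Sg \<alpha> S"

primrec atoms :: "('p, 'f, 'n, 'v) asrt \<Rightarrow> ('p, 'f, 'n, 'v) asrt set" where
  "atoms (AEq t u) = {AEq t u}"
| "atoms (APred P us) = {APred P us}"
| "atoms (AMem t l) = {AMem t l}"
| "atoms (AAnd \<alpha> \<beta>) = atoms \<alpha> \<union> atoms \<beta>"
| "atoms (AEx x \<alpha>) = atoms \<alpha>"
| "atoms (ASays k \<alpha>) = {ASays k \<alpha>}"

primrec hat :: "('p, 'f, 'n, 'v) asrt \<Rightarrow> ('p, 'f, 'n, 'v) asrt set" where
  "hat (AEq t u) = {AEq t u}"
| "hat (APred P us) = {APred P us}"
| "hat (AMem t l) = {AMem t l}"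
| "hat (AAnd \<alpha> \<beta>) = hat \<alpha> \<union> hat \<beta>"
| "hat (AEx x \<alpha>) = hat \<alpha>"
| "hat (ASays k \<alpha>) = insert (ASays k \<alpha>) (hat \<alpha>)"

text \<open>\<open>\<alpha>\<close> can be assembled from the assertions in \<open>X\<close> by introducing conjunctions,
  existential quantifiers and says. Without this requirement on witnesses, \<open>X = {}\<close> would be
  admissible for every \<open>\<alpha>\<close>, and the accompanying substitution would be unrelated to \<open>\<alpha>\<close>.\<close>

primrec assembles :: "('p, 'f, 'n, 'v) asrt set \<Rightarrow> ('p, 'f, 'n, 'v) asrt \<Rightarrow> bool" where
  "assembles X (AEq t u) = (AEq t u \<in> X)"
| "assembles X (APred P us) = (APred P us \<in> X)"
| "assembles X (AMem t l) = (AMem t l \<in> X)"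
| "assembles X (AAnd \<alpha> \<beta>) = (assembles X \<alpha> \<and> assembles X \<beta>)"
| "assembles X (AEx x \<alpha>) = assembles X \<alpha>"
| "assembles X (ASays k \<alpha>) = (ASays k \<alpha> \<in> X \<or> assembles X \<alpha>)"


section \<open>Assertion derivability\<close>

datatype rule = RAx | REq | RCons | RSym | RTrans | RProj | RAndI | RAndE | RSubst
  | RExI | RExE | RSay | RProm | RInt | RWk

text \<open>A proof tree records the last rule, the conclusion, the proofs of the term derivability
  premises and the proofs of the assertion premises.\<close>

datatype ('p, 'f, 'n, 'v) aprf =
  Inf (last_rule: rule) (concl: "('p, 'f, 'n, 'v) asrt")
    (tprems: "('f, 'n, 'v) dyp list") (prems: "('p, 'f, 'n, 'v) aprf list")

text \<open>Assertions are taken up to renaming of bound variables, which is made explicit in the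
  axiom rule. The intersection of lists of names keeps the order of the first list.\<close>

inductive aproof :: "('f, 'n, 'v) sys \<Rightarrow> ('f, 'n, 'v) trm set \<Rightarrow> ('p, 'f, 'n, 'v) asrt set \<Rightarrow>
    ('p, 'f, 'n, 'v) aprf \<Rightarrow> bool" for Sg where
  ax: "\<alpha> \<in> A \<Longrightarrow> alpha \<alpha> \<beta> \<Longrightarrow> aproof Sg S A (Inf RAx \<beta> [] [])"
| eq: "dproof Sg S d \<Longrightarrow> dconcl d = t \<Longrightarrow> aproof Sg S A (Inf REq (AEq t t) [d] [])"
| cons: "length ts = ar Sg f \<Longrightarrow> length us = ar Sg f \<Longrightarrow> length \<pi>s = ar Sg f \<Longrightarrow>
    (\<And>j. j < ar Sg f \<Longrightarrow> aproof Sg S A (\<pi>s ! j) \<and> concl (\<pi>s ! j) = AEq (ts ! j) (us ! j)) \<Longrightarrow>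
    aproof Sg S A (Inf RCons (AEq (Fun f ts) (Fun f us)) [] \<pi>s)"
| sym: "aproof Sg S A \<pi> \<Longrightarrow> concl \<pi> = AEq t u \<Longrightarrow> aproof Sg S A (Inf RSym (AEq u t) [] [\<pi>])"
| trans: "\<pi>s \<noteq> [] \<Longrightarrow> length ts = Suc (length \<pi>s) \<Longrightarrow>
    (\<And>j. j < length \<pi>s \<Longrightarrow> aproof Sg S A (\<pi>s ! j) \<and> concl (\<pi>s ! j) = AEq (ts ! j) (ts ! Suc j)) \<Longrightarrow>
    aproof Sg S A (Inf RTrans (AEq (hd ts) (last ts)) [] \<pi>s)"
| proj: "aproof Sg S A \<pi> \<Longrightarrow> concl \<pi> = AEq (Fun f ts) (Fun f us) \<Longrightarrow>
    length ts = ar Sg f \<Longrightarrow> length us = ar Sg f \<Longrightarrow> i < ar Sg f \<Longrightarrow>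
    (\<And>j. j < ar Sg f \<Longrightarrow> [0, j] \<in> aabs Sg (concl \<pi>) S \<and> [1, j] \<in> aabs Sg (concl \<pi>) S) \<Longrightarrow>
    aproof Sg S A (Inf RProj (AEq (ts ! i) (us ! i)) [] [\<pi>])"
| andI: "aproof Sg S A \<pi> \<Longrightarrow> aproof Sg S A \<pi>' \<Longrightarrow>
    aproof Sg S A (Inf RAndI (AAnd (concl \<pi>) (concl \<pi>')) [] [\<pi>, \<pi>'])"
| andE0: "aproof Sg S A \<pi> \<Longrightarrow> concl \<pi> = AAnd \<alpha> \<beta> \<Longrightarrow> aproof Sg S A (Inf RAndE \<alpha> [] [\<pi>])"
| andE1: "aproof Sg S A \<pi> \<Longrightarrow> concl \<pi> = AAnd \<alpha> \<beta> \<Longrightarrow> aproof Sg S A (Inf RAndE \<beta> [] [\<pi>])"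
| subst: "aproof Sg S A \<pi> \<Longrightarrow> concl \<pi> = AMem t l \<Longrightarrow> aproof Sg S A \<pi>' \<Longrightarrow> concl \<pi>' = AEq t u \<Longrightarrow>
    aproof Sg S A (Inf RSubst (AMem u l) [] [\<pi>, \<pi>'])"
| exI: "aproof Sg S A \<pi> \<Longrightarrow> x \<in> qvars Sg \<Longrightarrow> P = vpos x \<alpha> \<Longrightarrow> concl \<pi> = arepl \<alpha> P t \<Longrightarrow>
    vars t \<inter> bv \<alpha> = {} \<Longrightarrow> dproof Sg S d \<Longrightarrow> dconcl d = t \<Longrightarrow>
    P \<subseteq> aabs Sg \<alpha> (insert (Var x) S) \<Longrightarrow>
    aproof Sg S A (Inf RExI (AEx x \<alpha>) [d] [\<pi>])"
| exE: "aproof Sg S A \<pi> \<Longrightarrow> concl \<pi> = AEx x \<alpha> \<Longrightarrow>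
    y \<notin> (\<Union>s\<in>S. vars s) \<Longrightarrow> y \<notin> (\<Union>\<beta>\<in>A. fv \<beta> \<union> bv \<beta>) \<Longrightarrow>
    y \<notin> fv (AEx x \<alpha>) \<union> bv (AEx x \<alpha>) \<Longrightarrow> y \<notin> fv \<gamma> \<union> bv \<gamma> \<Longrightarrow>
    P = vpos x \<alpha> \<Longrightarrow> aproof Sg (insert (Var y) S) (insert (arepl \<alpha> P (Var y)) A) \<pi>' \<Longrightarrow>
    concl \<pi>' = \<gamma> \<Longrightarrow> aproof Sg S A (Inf RExE \<gamma> [] [\<pi>, \<pi>'])"
| say: "aproof Sg S A \<pi> \<Longrightarrow> dproof Sg S d \<Longrightarrow> dconcl d = k \<Longrightarrow>
    aproof Sg S A (Inf RSay (ASays k (concl \<pi>)) [d] [\<pi>])"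
| prom: "aproof Sg S A \<pi> \<Longrightarrow> concl \<pi> = AMem t [m] \<Longrightarrow>
    aproof Sg S A (Inf RProm (AEq t (Name m)) [] [\<pi>])"
| int: "\<pi>s \<noteq> [] \<Longrightarrow> length ls = length \<pi>s \<Longrightarrow>
    (\<And>j. j < length \<pi>s \<Longrightarrow> aproof Sg S A (\<pi>s ! j) \<and> concl (\<pi>s ! j) = AMem t (ls ! j)) \<Longrightarrow>
    aproof Sg S A (Inf RInt (AMem t (filter (\<lambda>m. \<forall>l\<in>set ls. m \<in> set l) (hd ls))) [] \<pi>s)"
| wk: "aproof Sg S A \<pi> \<Longrightarrow> concl \<pi> = AEq t (Name (l ! i)) \<Longrightarrow> i < length l \<Longrightarrow>
    length ds = length l \<Longrightarrow>
    (\<And>j. j < length l \<Longrightarrow> dproof Sg S (ds ! j) \<and> dconcl (ds ! j) = Name (l ! j)) \<Longrightarrow>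
    aproof Sg S A (Inf RWk (AMem t l) ds [\<pi>])"

definition aderiv :: "('f, 'n, 'v) sys \<Rightarrow> ('f, 'n, 'v) trm set \<times> ('p, 'f, 'n, 'v) asrt set \<Rightarrow>
    ('p, 'f, 'n, 'v) asrt \<Rightarrow> bool" where
  "aderiv Sg = (\<lambda>(S, A) \<alpha>. \<exists>\<pi>. aproof Sg S A \<pi> \<and> concl \<pi> = \<alpha>)"

primrec subproofs :: "('p, 'f, 'n, 'v) aprf \<Rightarrow> ('p, 'f, 'n, 'v) aprf set" where
  "subproofs (Inf r \<alpha> ds \<pi>s) = insert (Inf r \<alpha> ds \<pi>s) (\<Union> (set (map subproofs \<pi>s)))"

definition eq_proof :: "('f, 'n, 'v) sys \<Rightarrow> ('f, 'n, 'v) trm set \<times> ('p, 'f, 'n, 'v) asrt set \<Rightarrow>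
    ('p, 'f, 'n, 'v) asrt \<Rightarrow> ('p, 'f, 'n, 'v) aprf \<Rightarrow> bool" where
  "eq_proof Sg = (\<lambda>(S, A) \<alpha> \<pi>. aproof Sg S A \<pi> \<and> concl \<pi> = \<alpha> \<and>
     (\<forall>\<rho>\<in>subproofs \<pi>. last_rule \<rho> \<notin> {RAndI, RAndE, RExI, RExE, RSay}))"

definition eq_deriv :: "('f, 'n, 'v) sys \<Rightarrow> ('f, 'n, 'v) trm set \<times> ('p, 'f, 'n, 'v) asrt set \<Rightarrow>
    ('p, 'f, 'n, 'v) asrt \<Rightarrow> bool" where
  "eq_deriv Sg K \<alpha> \<longleftrightarrow> (\<exists>\<pi>. eq_proof Sg K \<alpha> \<pi>)"

definition has_cons :: "('p, 'f, 'n, 'v) aprf \<Rightarrow> bool" where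
  "has_cons \<pi> \<longleftrightarrow> (\<exists>\<rho>\<in>subproofs \<pi>. last_rule \<rho> = RCons)"

definition normal :: "('p, 'f, 'n, 'v) aprf \<Rightarrow> bool" where
  "normal \<pi> \<longleftrightarrow> (\<forall>\<rho>\<in>subproofs \<pi>.
     (\<forall>d\<in>set (tprems \<rho>). dnormal d) \<and>
     (last_rule \<rho> = RSym \<longrightarrow> (\<forall>\<kappa>\<in>set (prems \<rho>). last_rule \<kappa> \<in> {RAx, RProm})) \<and>
     (last_rule \<rho> = REq \<longrightarrow> (\<forall>d\<in>set (tprems \<rho>). ends_destr d)) \<and>
     (last_rule \<rho> = RTrans \<longrightarrow>
        (\<forall>\<kappa>\<in>set (prems \<rho>). last_rule \<kappa> \<noteq> RTrans \<and> (\<forall>a. concl \<kappa> \<noteq> AEq a a)) \<and>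
        (\<forall>j. Suc j < length (prems \<rho>) \<longrightarrow>
           \<not> (last_rule (prems \<rho> ! j) = RCons \<and> last_rule (prems \<rho> ! Suc j) = RCons))) \<and>
     (last_rule \<rho> = RInt \<longrightarrow> (\<forall>\<kappa>\<in>set (prems \<rho>). last_rule \<kappa> \<notin> {RInt, RWk})) \<and>
     (last_rule \<rho> = RProj \<longrightarrow> \<not> has_cons \<rho>))"

text \<open>Here \<open>Ty\<close> is the set of typed terms.\<close>

definition typed_proof :: "('f, 'n, 'v) trm set \<Rightarrow> ('p, 'f, 'n, 'v) aprf \<Rightarrow> bool" where
  "typed_proof Ty \<pi> \<longleftrightarrow> (\<forall>\<rho>\<in>subproofs \<pi>. \<forall>t u. concl \<rho> = AEq t u \<longrightarrow>
     has_cons \<rho> \<or> t = u \<or> (t \<in> Ty \<and> u \<in> Ty))"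


section \<open>Protocols and runs\<close>

type_synonym ('p, 'f, 'n, 'v) know = "('f, 'n, 'v) trm set \<times> ('p, 'f, 'n, 'v) asrt set"
type_synonym ('p, 'f, 'n, 'v) role = "(('p, 'f, 'n, 'v) asrt \<times> ('p, 'f, 'n, 'v) asrt) list"
type_synonym ('p, 'f, 'n, 'v) action = "'n \<times> ('p, 'f, 'n, 'v) asrt \<times> ('p, 'f, 'n, 'v) asrt"

definition update :: "('f, 'n, 'v) sys \<Rightarrow> ('p, 'f, 'n, 'v) know \<Rightarrow> ('p, 'f, 'n, 'v) asrt \<Rightarrow>
    ('p, 'f, 'n, 'v) know" where
  "update Sg = (\<lambda>(X, \<Phi>) \<alpha>. (X \<union> pubs Sg \<alpha>, \<Phi> \<union> {\<alpha>}))"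

definition ker :: "('p, 'f, 'n, 'v) know \<Rightarrow> ('p, 'f, 'n, 'v) know" where
  "ker = (\<lambda>(S, A). (S \<union> Var ` (\<Union>\<alpha>\<in>A. bv \<alpha>), \<Union>\<alpha>\<in>A. atoms \<alpha>))"

definition ksub :: "('f, 'n, 'v) sub \<Rightarrow> ('p, 'f, 'n, 'v) know \<Rightarrow> ('p, 'f, 'n, 'v) know" where
  "ksub \<tau> = (\<lambda>(S, A). (app \<tau> ` S, asub \<tau> ` A))"

definition role_fv :: "('p, 'f, 'n, 'v) role \<Rightarrow> 'v set" where
  "role_fv \<eta> = (\<Union>(\<beta>, \<alpha>)\<in>set \<eta>. fv \<beta> \<union> fv \<alpha>)"

definition agent_vars :: "('p, 'f, 'n, 'v) role \<Rightarrow> 'v set" where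
  "agent_vars \<eta> = {x. \<exists>j<length \<eta>. x \<in> fv (snd (\<eta> ! j)) \<and> x \<notin> fv (fst (\<eta> ! j)) \<and>
     x \<notin> role_fv (take j \<eta>)}"

definition protocol :: "('f, 'n, 'v) sys \<Rightarrow> ('p, 'f, 'n, 'v) role set \<Rightarrow> bool" where
  "protocol Sg Pr \<longleftrightarrow> finite Pr \<and>
     (\<forall>\<eta>\<in>Pr. \<forall>(\<beta>, \<alpha>)\<in>set \<eta>. wf_asrt Sg \<beta> \<and> wf_asrt Sg \<alpha>)"

text \<open>A session is obtained from a prefix of a role by instantiating the agent variables by names;
  the remaining free variables, and the bound variables, may be renamed apart.\<close>

definition session :: "('f, 'n, 'v) sys \<Rightarrow> ('p, 'f, 'n, 'v) role set \<Rightarrow>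
    ('p, 'f, 'n, 'v) action list \<Rightarrow> bool" where
  "session Sg Pr s \<longleftrightarrow>
     (\<exists>\<eta>\<in>Pr. \<exists>l\<le>length \<eta>. \<exists>u\<in>agents Sg. \<exists>\<rho> :: ('f, 'n, 'v) sub.
        dom \<rho> = role_fv \<eta> \<and>
        (\<forall>x\<in>agent_vars \<eta>. \<exists>m. \<rho> x = Some (Name m)) \<and>
        (\<forall>x\<in>role_fv \<eta> - agent_vars \<eta>. \<exists>y. y \<notin> qvars Sg \<and> \<rho> x = Some (Var y)) \<and>
        inj_on \<rho> (role_fv \<eta> - agent_vars \<eta>) \<and>
        length s = l \<and>
        (\<forall>j<l. case s ! j of (u', \<beta>, \<alpha>) \<Rightarrow>
           u' = u \<and> wf_asrt Sg \<beta> \<and> wf_asrt Sg \<alpha> \<and>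
           alpha (asub \<rho> (fst (\<eta> ! j))) \<beta> \<and> alpha (asub \<rho> (snd (\<eta> ! j))) \<alpha>))"

definition act_fv :: "('p, 'f, 'n, 'v) action list \<Rightarrow> 'v set" where
  "act_fv \<xi> = role_fv (map snd \<xi>)"

definition coherent :: "('p, 'f, 'n, 'v) action list set \<Rightarrow> bool" where
  "coherent Ss \<longleftrightarrow> (\<forall>s\<in>Ss. \<forall>s'\<in>Ss. s \<noteq> s' \<longrightarrow> act_fv s \<inter> act_fv s' = {})"

definition interleaving :: "('p, 'f, 'n, 'v) action list set \<Rightarrow> ('p, 'f, 'n, 'v) action list \<Rightarrow> bool" where
  "interleaving Ss \<xi> \<longleftrightarrow> (\<exists>lab :: nat \<Rightarrow> ('p, 'f, 'n, 'v) action list.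
     (\<forall>i<length \<xi>. lab i \<in> Ss) \<and>
     (\<forall>s\<in>Ss. map ((!) \<xi>) (filter (\<lambda>i. lab i = s) [0..<length \<xi>]) = s))"

text \<open>Actions of a run are numbered from 1.\<close>

definition actor :: "('p, 'f, 'n, 'v) action list \<Rightarrow> nat \<Rightarrow> 'n" where
  "actor \<xi> i = fst (\<xi> ! (i - 1))"

definition recv :: "('p, 'f, 'n, 'v) action list \<Rightarrow> nat \<Rightarrow> ('p, 'f, 'n, 'v) asrt" where
  "recv \<xi> i = fst (snd (\<xi> ! (i - 1)))"

definition sent :: "('p, 'f, 'n, 'v) action list \<Rightarrow> nat \<Rightarrow> ('p, 'f, 'n, 'v) asrt" where
  "sent \<xi> i = snd (snd (\<xi> ! (i - 1)))"

definition act_binders :: "('p, 'f, 'n, 'v) action list \<Rightarrow> 'v list" where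
  "act_binders \<xi> = concat (map (\<lambda>(u, \<beta>, \<alpha>). binders \<beta> @ binders \<alpha>) \<xi>)"

definition run :: "('f, 'n, 'v) sys \<Rightarrow> ('p, 'f, 'n, 'v) role set \<Rightarrow> ('n \<Rightarrow> ('f, 'n, 'v) trm set) \<Rightarrow>
    ('p, 'f, 'n, 'v) action list \<Rightarrow> ('f, 'n, 'v) sub \<Rightarrow>
    (nat \<Rightarrow> 'n \<Rightarrow> ('p, 'f, 'n, 'v) know) \<Rightarrow> bool" where
  "run Sg Pr init \<xi> \<sigma> K \<longleftrightarrow>
     \<comment> \<open>interleaving of sessions, with distinct variables\<close>
     (\<exists>Ss. finite Ss \<and> (\<forall>s\<in>Ss. session Sg Pr s) \<and> coherent Ss \<and> interleaving Ss \<xi>) \<and>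
     act_fv \<xi> \<inter> qvars Sg = {} \<and>
     act_fv \<xi> \<inter> set (act_binders \<xi>) = {} \<and>
     distinct (act_binders \<xi>) \<and>
     \<comment> \<open>initial knowledge\<close>
     (\<forall>a\<in>agents Sg. \<forall>t\<in>init a. wf_trm (ar Sg) t \<and> vars t \<inter> qvars Sg = {}) \<and>
     \<comment> \<open>ground substitution\<close>
     dom \<sigma> = act_fv \<xi> \<and>
     (\<forall>t\<in>ran \<sigma>. wf_trm (ar Sg) t \<and> vars t = {}) \<and>
     \<comment> \<open>knowledge functions\<close>
     (\<forall>a\<in>agents Sg. K 0 a = (init a, {})) \<and>
     (\<forall>i\<in>{1..length \<xi>}.
        (\<forall>a\<in>agents Sg - {actor \<xi> i, intruder Sg}. K i a = K (i - 1) a) \<and>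
        K i (actor \<xi> i) = update Sg (K (i - 1) (actor \<xi> i)) (recv \<xi> i) \<and>
        K i (intruder Sg) = update Sg (K (i - 1) (intruder Sg)) (sent \<xi> i) \<and>
        aderiv Sg (K i (actor \<xi> i)) (sent \<xi> i) \<and>
        aderiv Sg (ksub \<sigma> (K (i - 1) (intruder Sg))) (asub \<sigma> (recv \<xi> i)))"

text \<open>\<open>X\<close> and \<open>\<mu>\<close> witness the derivability, from a knowledge state with kernel \<open>(T; E)\<close>
  and under \<open>\<sigma>\<close>, of the assertion \<open>\<beta>\<close>.\<close>

definition witness :: "('f, 'n, 'v) sys \<Rightarrow> ('f, 'n, 'v) sub \<Rightarrow> ('p, 'f, 'n, 'v) know \<Rightarrow>
    ('p, 'f, 'n, 'v) asrt \<Rightarrow> ('p, 'f, 'n, 'v) asrt set \<Rightarrow> ('f, 'n, 'v) sub \<Rightarrow> bool" where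
  "witness Sg \<sigma> TE \<beta> X \<mu> \<longleftrightarrow>
     X \<subseteq> hat \<beta> \<and> assembles X \<beta> \<and>
     dom \<mu> = bv \<beta> - (\<Union>\<gamma>\<in>X. bv \<gamma>) \<and>
     (\<forall>x\<in>dom \<mu>. dy Sg (fst (ksub \<sigma> TE)) (the (\<mu> x))) \<and>
     (\<forall>\<gamma>\<in>X. eq_deriv Sg (ksub \<sigma> TE) (asub (scomp \<sigma> \<mu>) \<gamma>))"

primrec omega :: "('f, 'n, 'v) sub \<Rightarrow> (nat \<Rightarrow> ('f, 'n, 'v) sub) \<Rightarrow> (nat \<Rightarrow> ('f, 'n, 'v) sub) \<Rightarrow>
    nat \<Rightarrow> ('f, 'n, 'v) sub" where
  "omega \<sigma> \<mu> \<theta> 0 = \<sigma>"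
| "omega \<sigma> \<mu> \<theta> (Suc i) = scomp (scomp (omega \<sigma> \<mu> \<theta> i) (\<mu> (Suc i))) (\<theta> (Suc i))"

definition know_st :: "('f, 'n, 'v) sys \<Rightarrow> ('p, 'f, 'n, 'v) know \<Rightarrow> ('f, 'n, 'v) trm set" where
  "know_st Sg = (\<lambda>(S, A). (\<Union>t\<in>S. st t) \<union> (\<Union>\<alpha>\<in>A. ast Sg \<alpha>))"

text \<open>All subterms of the kernels of the intruder (from the initial state on) and of the acting
  agents (there is none at index 0).\<close>

definition run_terms :: "('f, 'n, 'v) sys \<Rightarrow> ('p, 'f, 'n, 'v) action list \<Rightarrow>
    (nat \<Rightarrow> 'n \<Rightarrow> ('p, 'f, 'n, 'v) know) \<Rightarrow> ('f, 'n, 'v) trm set" where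
  "run_terms Sg \<xi> K =
     (\<Union>i\<in>{0..length \<xi>}. know_st Sg (ker (K i (intruder Sg)))) \<union>
     (\<Union>i\<in>{1..length \<xi>}. know_st Sg (ker (K i (actor \<xi> i))))"

definition typed_terms :: "('f, 'n, 'v) sys \<Rightarrow> ('p, 'f, 'n, 'v) action list \<Rightarrow>
    (nat \<Rightarrow> 'n \<Rightarrow> ('p, 'f, 'n, 'v) know) \<Rightarrow> ('f, 'n, 'v) sub \<Rightarrow> ('f, 'n, 'v) sub \<Rightarrow>
    ('f, 'n, 'v) trm set" where
  "typed_terms Sg \<xi> K \<sigma> \<omega> =
     app \<sigma> ` (run_terms Sg \<xi> K - range Var) \<union> app \<omega> ` run_terms Sg \<xi> K \<union> Var ` qvars Sg"

end

theory Submission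
  imports Defs
begin

text \<open>The substitution \<open>\<omega>\<close> is a model of all the kernels: by induction along the run, applying
  \<open>\<omega>\<close> to the proofs of the witnesses shows that \<open>\<omega>(t) = \<omega>(u)\<close> for every equation and
  \<open>\<omega>(t) \<in> l\<close> for every membership of a kernel. For this one needs that \<open>\<omega>\<close> absorbs \<open>\<sigma>\<close>, the
  \<open>\<mu>\<^sub>j\<close> and the \<open>\<theta>\<^sub>j\<close>, hence also itself. Moreover all terms occurring in the equations of a kernel are
  derivable, being built by constructors from public terms and bound variables.

  The model makes normalization go through. In a chain of equations between two terms with head
  \<open>f\<close>, all nodes have the same value, so the terms at which cons steps meet other steps again have
  head \<open>f\<close>; as their arguments are derivable, proj can be moved into the segments without cons.

  Every normal proof is typed. The critical case is a projection from a nontrivial cons-free equation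
  between compound typed terms: they are not both of the form \<open>\<omega>(r)\<close>, as \<open>\<omega>\<close> is an idempotent model,
  so one of them is \<open>\<sigma>(r)\<close> with \<open>r\<close> compound, and the other one is either also of this form or equal
  to \<open>\<omega>(r)\<close>. In both cases the arguments are typed.\<close>

section \<open>Equational derivability\<close>

lemma Ball_subproofs_Inf:
  "(\<forall>\<rho>\<in>subproofs (Inf r \<alpha> ds \<pi>s). Q \<rho>) \<longleftrightarrow>
     Q (Inf r \<alpha> ds \<pi>s) \<and> (\<forall>\<pi>\<in>set \<pi>s. \<forall>\<rho>\<in>subproofs \<pi>. Q \<rho>)"
  by auto

lemma normal_Inf:
  "normal (Inf r \<alpha> ds \<pi>s) \<longleftrightarrow> (\<forall>\<pi>\<in>set \<pi>s. normal \<pi>) \<and> list_all dnormal ds \<and>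
     (r = RSym \<longrightarrow> (\<forall>\<kappa>\<in>set \<pi>s. last_rule \<kappa> \<in> {RAx, RProm})) \<and>
     (r = REq \<longrightarrow> list_all ends_destr ds) \<and>
     (r = RTrans \<longrightarrow> (\<forall>\<kappa>\<in>set \<pi>s. last_rule \<kappa> \<noteq> RTrans \<and> (\<forall>a. concl \<kappa> \<noteq> AEq a a)) \<and>
        (\<forall>j. Suc j < length \<pi>s \<longrightarrow>
           \<not> (last_rule (\<pi>s ! j) = RCons \<and> last_rule (\<pi>s ! Suc j) = RCons))) \<and>
     (r = RInt \<longrightarrow> (\<forall>\<kappa>\<in>set \<pi>s. last_rule \<kappa> \<notin> {RInt, RWk})) \<and>
     (r = RProj \<longrightarrow> \<not> has_cons (Inf r \<alpha> ds \<pi>s))"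
  unfolding normal_def Ball_subproofs_Inf by (simp add: list_all_iff conj_ac)

lemma has_cons_Inf [simp]:
  "has_cons (Inf r \<alpha> ds \<pi>s) \<longleftrightarrow> r = RCons \<or> (\<exists>\<pi>\<in>set \<pi>s. has_cons \<pi>)"
  by (auto simp: has_cons_def)

definition eq_only :: "('p, 'f, 'n, 'v) aprf \<Rightarrow> bool" where
  "eq_only \<pi> \<longleftrightarrow> (\<forall>\<rho>\<in>subproofs \<pi>. last_rule \<rho> \<notin> {RAndI, RAndE, RExI, RExE, RSay})"

lemma eq_only_Inf [simp]:
  "eq_only (Inf r \<alpha> ds \<pi>s) \<longleftrightarrow> r \<notin> {RAndI, RAndE, RExI, RExE, RSay} \<and> (\<forall>\<pi>\<in>set \<pi>s. eq_only \<pi>)"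
  by (auto simp: eq_only_def)

text \<open>Equations contain no binders, so renaming cannot change them. The equivalence, instead
  of one implication, lets the induction pass the symmetry rule.\<close>

lemma alpha_AEq_iff: "alpha \<alpha> \<beta> \<Longrightarrow> \<alpha> = AEq t u \<longleftrightarrow> \<beta> = AEq t u"
  by (induction rule: alpha.induct) auto

lemma alpha_AMem_iff: "alpha \<alpha> \<beta> \<Longrightarrow> \<alpha> = AMem t l \<longleftrightarrow> \<beta> = AMem t l"
  by (induction rule: alpha.induct) auto

lemma dy_Fun: "length ts = ar Sg f \<Longrightarrow> (\<And>t. t \<in> set ts \<Longrightarrow> dy Sg S t) \<Longrightarrow> dy Sg S (Fun f ts)"
proof -
  assume l: "length ts = ar Sg f" and "\<And>t. t \<in> set ts \<Longrightarrow> dy Sg S t"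
  then have "\<forall>t\<in>set ts. \<exists>d. dproof Sg S d \<and> dconcl d = t" by (auto simp: dy_def)
  then obtain D where D: "\<forall>t\<in>set ts. dproof Sg S (D t) \<and> dconcl (D t) = t" by metis
  have "map (dconcl \<circ> D) ts = ts" using D by (simp add: map_idI)
  then have "dproof Sg S (DCon f (map D ts)) \<and> dconcl (DCon f (map D ts)) = Fun f ts"
    using D l by (auto simp: list_all_iff)
  then show ?thesis unfolding dy_def by blast
qed

lemma dy_ax: "t \<in> S \<Longrightarrow> dy Sg S t"
  unfolding dy_def by (metis dconcl.simps(1) dproof.simps(1))

text \<open>The only proper prefix of \<open>[j]\<close> is the root, so abstractability of one
  child involves the root and all siblings.\<close>

lemma tabs_child_iff:
  "[j] \<in> tabs Sg S (Fun f ts) \<longleftrightarrow> j < length ts \<and> dy Sg S (Fun f ts) \<and> (\<forall>k<length ts. dy Sg S (ts ! k))"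
proof -
  have *: "(\<exists>r. r \<noteq> [] \<and> [j] = q @ r) \<longleftrightarrow> q = []" for q :: "nat list"
    by (auto simp: Cons_eq_append_conv)
  show ?thesis by (auto simp: tabs_def pos_def * split: if_splits)
qed

text \<open>A calculus without proof trees: \<open>trans\<close> is binary, renaming is gone, and
  the side condition of \<open>proj\<close> is cut down to derivability of the arguments. Arbitrary
  proofs are translated into it, and normal proofs are rebuilt from it rule by rule.\<close>

inductive der :: "('f, 'n, 'v) sys \<Rightarrow> ('f, 'n, 'v) trm set \<Rightarrow> ('p, 'f, 'n, 'v) asrt set \<Rightarrow>
    ('p, 'f, 'n, 'v) asrt \<Rightarrow> bool" for Sg S A where
  der_eq_ax: "AEq t u \<in> A \<Longrightarrow> der Sg S A (AEq t u)"
| der_mem_ax: "AMem t l \<in> A \<Longrightarrow> der Sg S A (AMem t l)"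
| der_refl: "dy Sg S t \<Longrightarrow> der Sg S A (AEq t t)"
| der_cons: "length ts = ar Sg f \<Longrightarrow> length us = ar Sg f \<Longrightarrow>
    (\<And>j. j < ar Sg f \<Longrightarrow> der Sg S A (AEq (ts ! j) (us ! j))) \<Longrightarrow>
    der Sg S A (AEq (Fun f ts) (Fun f us))"
| der_sym: "der Sg S A (AEq t u) \<Longrightarrow> der Sg S A (AEq u t)"
| der_trans: "der Sg S A (AEq t u) \<Longrightarrow> der Sg S A (AEq u v) \<Longrightarrow> der Sg S A (AEq t v)"
| der_proj: "der Sg S A (AEq (Fun f ts) (Fun f us)) \<Longrightarrow>
    length ts = ar Sg f \<Longrightarrow> length us = ar Sg f \<Longrightarrow> i < ar Sg f \<Longrightarrow>
    (\<And>j. j < ar Sg f \<Longrightarrow> dy Sg S (ts ! j) \<and> dy Sg S (us ! j)) \<Longrightarrow>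
    der Sg S A (AEq (ts ! i) (us ! i))"
| der_subst: "der Sg S A (AMem t l) \<Longrightarrow> der Sg S A (AEq t u) \<Longrightarrow> der Sg S A (AMem u l)"
| der_prom: "der Sg S A (AMem t [m]) \<Longrightarrow> der Sg S A (AEq t (Name m))"
| der_int: "ls \<noteq> [] \<Longrightarrow> (\<And>l. l \<in> set ls \<Longrightarrow> der Sg S A (AMem t l)) \<Longrightarrow>
    der Sg S A (AMem t (filter (\<lambda>m. \<forall>l\<in>set ls. m \<in> set l) (hd ls)))"
| der_wk: "der Sg S A (AEq t (Name n)) \<Longrightarrow> n \<in> set l \<Longrightarrow> (\<And>m. m \<in> set l \<Longrightarrow> dy Sg S (Name m)) \<Longrightarrow>
    der Sg S A (AMem t l)"

lemma der_trans_list: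
  "length ts = Suc n \<Longrightarrow> n > 0 \<Longrightarrow> (\<And>j. j < n \<Longrightarrow> der Sg S A (AEq (ts ! j) (ts ! Suc j))) \<Longrightarrow>
    der Sg S A (AEq (hd ts) (last ts))"
proof -
  assume l: "length ts = Suc n" "n > 0" and st: "\<And>j. j < n \<Longrightarrow> der Sg S A (AEq (ts ! j) (ts ! Suc j))"
  have "j < n \<Longrightarrow> der Sg S A (AEq (ts ! 0) (ts ! Suc j))" for j
  proof (induction j)
    case (Suc j)
    then show ?case using st[of "Suc j"] der.der_trans by fastforce
  qed (use st in auto)
  from this[of "n - 1"] show ?thesis using l
    by (metis Suc_diff_1 diff_Suc_1 diff_less hd_conv_nth last_conv_nth length_0_conv less_numeral_extra(1) nat.distinct(1))
qed

text \<open>Equations and memberships go together because \<open>prom\<close>, \<open>subst\<close>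
  and \<open>wk\<close> pass between them.\<close>

lemma aproof_der_aux:
  assumes "aproof Sg S A \<pi>" "eq_only \<pi>"
  shows "(\<forall>t u. concl \<pi> = AEq t u \<longrightarrow> der Sg S A (AEq t u)) \<and>
    (\<forall>t l. concl \<pi> = AMem t l \<longrightarrow> der Sg S A (AMem t l))"
  using assms
proof (induction rule: aproof.induct)
  case (ax \<alpha> A \<beta> S)
  have "\<beta> = AEq t u \<Longrightarrow> \<alpha> = AEq t u" "\<beta> = AMem t l \<Longrightarrow> \<alpha> = AMem t l" for t u l
    using alpha_AEq_iff[OF ax.hyps(2)] alpha_AMem_iff[OF ax.hyps(2)] by blast+
  then show ?case using ax.hyps(1) by (auto intro: der_eq_ax der_mem_ax)
next
  case (eq S d t A)
  then show ?case by (auto simp: dy_def intro!: der_refl)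
next
  case (cons ts f us \<pi>s S A)
  have "der Sg S A (AEq (ts ! j) (us ! j))" if "j < ar Sg f" for j
    using cons.IH[OF that] cons.prems cons.hyps(3) that by simp
  then show ?case using cons by (auto intro!: der_cons)
next
  case (sym S A \<pi> t u)
  then show ?case by (auto intro: der_sym)
next
  case (trans \<pi>s ts S A)
  have "der Sg S A (AEq (ts ! j) (ts ! Suc j))" if "j < length \<pi>s" for j
    using trans.IH[OF that] trans.prems that by simp
  then have "der Sg S A (AEq (hd ts) (last ts))"
    using trans.hyps(1) by (intro der_trans_list[OF trans.hyps(2)]) auto
  then show ?case by simp
next
  case (proj S A \<pi> f ts us i)
  have "dy Sg S (ts ! j) \<and> dy Sg S (us ! j)" if "j < ar Sg f" for j
    using proj.hyps that tabs_child_iff[of j Sg S f ts] tabs_child_iff[of j Sg S f us] by auto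
  then have "der Sg S A (AEq (ts ! i) (us ! i))" using proj
    by (intro der_proj[of Sg S A f ts us i]) auto
  then show ?case by simp
next
  case (subst S A \<pi> t l \<pi>' u)
  then show ?case by (auto intro: der_subst)
next
  case (prom S A \<pi> t m)
  then show ?case by (auto intro: der_prom)
next
  case (int \<pi>s ls S A t)
  have "der Sg S A (AMem t (ls ! j))" if "j < length \<pi>s" for j
    using int.IH[OF that] int.prems that by simp
  then have "der Sg S A (AMem t l)" if "l \<in> set ls" for l
    using int.hyps(2) that by (auto simp: in_set_conv_nth)
  then show ?case using int.hyps by (auto intro!: der_int)
next
  case (wk S A \<pi> t l i ds)
  have "dy Sg S (Name m)" if "m \<in> set l" for m
    using wk that by (auto simp: in_set_conv_nth dy_def)
  then have "der Sg S A (AMem t l)" using wk by (intro der_wk[of Sg S A t "l ! i"]) auto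
  then show ?case by simp
qed auto

fun is_eqn :: "('p, 'f, 'n, 'v) asrt \<Rightarrow> bool" where
  "is_eqn (AEq t u) = True" | "is_eqn (AMem t l) = True" | "is_eqn _ = False"

lemma aproof_der: "aproof Sg S A \<pi> \<Longrightarrow> eq_only \<pi> \<Longrightarrow> is_eqn (concl \<pi>) \<Longrightarrow> der Sg S A (concl \<pi>)"
  using aproof_der_aux[of Sg S A \<pi>] by (cases "concl \<pi>") auto

lemma eq_deriv_der: "eq_deriv Sg (S, A) \<gamma> \<Longrightarrow> is_eqn \<gamma> \<Longrightarrow> der Sg S A \<gamma>"
  using aproof_der by (fastforce simp: eq_deriv_def eq_proof_def eq_only_def)

section \<open>Models, and derivability of the terms in derived assertions\<close>

fun holds :: "('f, 'n, 'v) sub \<Rightarrow> ('p, 'f, 'n, 'v) asrt \<Rightarrow> bool" where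
  "holds \<tau> (AEq t u) = (app \<tau> t = app \<tau> u)"
| "holds \<tau> (AMem t l) = (app \<tau> t \<in> Name ` set l)"
| "holds \<tau> _ = True"

lemma app_simps [simp]:
  "app \<tau> (Name m) = Name m" "app \<tau> (Fun f ts) = Fun f (map (app \<tau>) ts)"
  by (auto simp: app_def)

text \<open>Truth is equality in the free term algebra, where constructors are injective; this makes
  \<open>proj\<close> sound.\<close>

lemma der_holds: "der Sg S A \<gamma> \<Longrightarrow> (\<And>\<gamma>. \<gamma> \<in> A \<Longrightarrow> holds \<tau> \<gamma>) \<Longrightarrow> holds \<tau> \<gamma>"
proof (induction rule: der.induct)
  case (der_eq_ax t u) then show ?case by blast
next
  case (der_mem_ax t l) then show ?case by blast
next
  case (der_cons ts f us)
  then show ?case by (auto intro!: nth_equalityI)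
next
  case (der_proj f ts us i)
  then have "map (app \<tau>) ts ! i = map (app \<tau>) us ! i" by simp
  then show ?case using der_proj by simp
next
  case (der_int ls t)
  then have *: "\<forall>l\<in>set ls. app \<tau> t \<in> Name ` set l" and "hd ls \<in> set ls" by auto
  \<comment> \<open>The value of \<open>t\<close> is a single name; lying in every list, it survives
    the intersection.\<close>
  then obtain m where m: "m \<in> set (hd ls)" "app \<tau> t = Name m" by blast
  with * show ?case by fastforce
qed auto

fun terms_dy :: "('f, 'n, 'v) sys \<Rightarrow> ('f, 'n, 'v) trm set \<Rightarrow> ('p, 'f, 'n, 'v) asrt \<Rightarrow> bool" where
  "terms_dy Sg S (AEq t u) = (dy Sg S t \<and> dy Sg S u)"
| "terms_dy Sg S (AMem t l) = (dy Sg S t \<and> (\<forall>m\<in>set l. dy Sg S (Name m)))"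
| "terms_dy Sg S _ = True"

text \<open>Most rules only rearrange or combine terms already known to be derivable;
  \<open>proj\<close> and \<open>wk\<close> carry the missing derivations as premises.\<close>

lemma der_terms_dy: "der Sg S A \<gamma> \<Longrightarrow> (\<And>\<gamma>. \<gamma> \<in> A \<Longrightarrow> terms_dy Sg S \<gamma>) \<Longrightarrow> terms_dy Sg S \<gamma>"
proof (induction rule: der.induct)
  case (der_eq_ax t u) then show ?case by blast
next
  case (der_mem_ax t l) then show ?case by blast
next
  case (der_cons ts f us)
  then show ?case by (auto intro!: dy_Fun simp: in_set_conv_nth)
next
  case (der_int ls t)
  then have "\<forall>l\<in>set ls. dy Sg S t \<and> (\<forall>m\<in>set l. dy Sg S (Name m))" and "hd ls \<in> set ls" by auto
  then show ?case by auto
qed auto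


section \<open>Normalization\<close>

text \<open>Derivability of the terms in \<open>A\<close> makes reflexivity available for every side
  of a derived equation; the model \<open>\<tau>\<close> controls the heads along chains of
  equations.\<close>

locale eq_model =
  fixes Sg :: "('f, 'n, 'v) sys" and S :: "('f, 'n, 'v) trm set"
    and A :: "('p, 'f, 'n, 'v) asrt set" and \<tau> :: "('f, 'n, 'v) sub"
  assumes dy_system: "dy_system Sg"
    and wf_S: "s \<in> S \<Longrightarrow> wf_trm (ar Sg) s"
    and A_dy: "\<gamma> \<in> A \<Longrightarrow> terms_dy Sg S \<gamma>"
    and A_holds: "\<gamma> \<in> A \<Longrightarrow> holds \<tau> \<gamma>"
begin

definition good :: "('p, 'f, 'n, 'v) aprf \<Rightarrow> bool" where
  "good \<pi> \<longleftrightarrow> aproof Sg S A \<pi> \<and> eq_only \<pi> \<and> normal \<pi>"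

definition good_concl :: "('p, 'f, 'n, 'v) asrt \<Rightarrow> bool" where
  "good_concl \<gamma> \<longleftrightarrow> (\<exists>\<pi>. good \<pi> \<and> concl \<pi> = \<gamma>)"

abbreviation E :: "('f, 'n, 'v) trm \<Rightarrow> ('f, 'n, 'v) trm \<Rightarrow> bool" where
  "E t u \<equiv> good_concl (AEq t u)"

text \<open>\<open>exE\<close> is excluded because its second premise is proved from an extended
  knowledge state.\<close>

lemma aproof_prems:
  "aproof Sg S A (Inf r \<gamma> ds \<pi>s) \<Longrightarrow> r \<noteq> RExE \<Longrightarrow> \<pi> \<in> set \<pi>s \<Longrightarrow> aproof Sg S A \<pi>"
  by (erule aproof.cases) (auto simp: in_set_conv_nth less_Suc_eq)

lemma good_Inf:
  "good (Inf r \<gamma> ds \<pi>s) \<longleftrightarrow> aproof Sg S A (Inf r \<gamma> ds \<pi>s) \<and>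
     r \<notin> {RAndI, RAndE, RExI, RExE, RSay} \<and>
     (\<forall>\<pi>\<in>set \<pi>s. good \<pi>) \<and> list_all dnormal ds \<and>
     (r = RSym \<longrightarrow> (\<forall>\<kappa>\<in>set \<pi>s. last_rule \<kappa> \<in> {RAx, RProm})) \<and>
     (r = REq \<longrightarrow> list_all ends_destr ds) \<and>
     (r = RTrans \<longrightarrow> (\<forall>\<kappa>\<in>set \<pi>s. last_rule \<kappa> \<noteq> RTrans \<and> (\<forall>a. concl \<kappa> \<noteq> AEq a a)) \<and>
        (\<forall>j. Suc j < length \<pi>s \<longrightarrow>
           \<not> (last_rule (\<pi>s ! j) = RCons \<and> last_rule (\<pi>s ! Suc j) = RCons))) \<and>
     (r = RInt \<longrightarrow> (\<forall>\<kappa>\<in>set \<pi>s. last_rule \<kappa> \<notin> {RInt, RWk})) \<and>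
     (r = RProj \<longrightarrow> (\<forall>\<pi>\<in>set \<pi>s. \<not> has_cons \<pi>))"
  using aproof_prems[of r \<gamma> ds \<pi>s] unfolding good_def normal_Inf eq_only_Inf has_cons_Inf by blast

lemma good_der: "good \<pi> \<Longrightarrow> is_eqn (concl \<pi>) \<Longrightarrow> der Sg S A (concl \<pi>)"
  using aproof_der good_def by blast

lemma good_holds: "good \<pi> \<Longrightarrow> concl \<pi> = AEq t u \<Longrightarrow> app \<tau> t = app \<tau> u"
  using der_holds[OF good_der, of \<pi> \<tau>] A_holds by simp

lemma good_mem_holds: "good \<pi> \<Longrightarrow> concl \<pi> = AMem t l \<Longrightarrow> app \<tau> t \<in> Name ` set l"
  using der_holds[OF good_der, of \<pi> \<tau>] A_holds by simp

lemma E_dy: "E t u \<Longrightarrow> dy Sg S t" "E t u \<Longrightarrow> dy Sg S u"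
  using der_terms_dy[OF good_der] A_dy by (fastforce simp: good_concl_def)+

lemma dy_normal:
  assumes "dy Sg S t"
  obtains d where "dproof Sg S d" "dconcl d = t" "dnormal d"
  using assms dy_system wf_S unfolding dy_system_def by meson

lemma good_cons:
  assumes "length ts = ar Sg f" "length us = ar Sg f" "\<And>j. j < ar Sg f \<Longrightarrow> E (ts ! j) (us ! j)"
  obtains \<pi> where "good \<pi>" "last_rule \<pi> = RCons" "concl \<pi> = AEq (Fun f ts) (Fun f us)"
proof -
  have "\<forall>j. \<exists>\<pi>. j < ar Sg f \<longrightarrow> good \<pi> \<and> concl \<pi> = AEq (ts ! j) (us ! j)"
    using assms(3) by (auto simp: good_concl_def)
  then obtain g where g: "\<And>j. j < ar Sg f \<Longrightarrow> good (g j) \<and> concl (g j) = AEq (ts ! j) (us ! j)"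
    by metis
  let ?\<pi> = "Inf RCons (AEq (Fun f ts) (Fun f us)) [] (map g [0..<ar Sg f])"
  have "aproof Sg S A ?\<pi>"
    using assms(1,2) g by (intro aproof.cons) (auto simp: good_def)
  then have "good ?\<pi>" using g by (auto simp: good_Inf)
  then show ?thesis using that by simp
qed

lemma E_cons:
  "length ts = ar Sg f \<Longrightarrow> length us = ar Sg f \<Longrightarrow> (\<And>j. j < ar Sg f \<Longrightarrow> E (ts ! j) (us ! j)) \<Longrightarrow>
    E (Fun f ts) (Fun f us)"
  using good_cons good_concl_def by metis

lemma good_cons_cases:
  assumes "good \<pi>" "last_rule \<pi> = RCons" "concl \<pi> = AEq t u"
  obtains f ts us where "t = Fun f ts" "u = Fun f us" "length ts = ar Sg f" "length us = ar Sg f"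
    "\<And>j. j < ar Sg f \<Longrightarrow> E (ts ! j) (us ! j)"
proof -
  obtain ds \<pi>s where \<pi>: "\<pi> = Inf RCons (AEq t u) ds \<pi>s" using assms(2,3) by (cases \<pi>) auto
  have good: "\<forall>\<kappa>\<in>set \<pi>s. good \<kappa>" and "aproof Sg S A \<pi>" using assms(1) \<pi> by (auto simp: good_Inf)
  from this(2)[unfolded \<pi>] show ?thesis
  proof cases
    case (cons ts f us)
    then show ?thesis using that good nth_mem good_concl_def by metis
  qed
qed

text \<open>Normality lets \<open>eq\<close> follow only a destructor. The trailing constructors of
  a normal term proof therefore become \<open>cons\<close> steps, and \<open>eq\<close> is applied
  where they end.\<close>

lemma E_refl:
  assumes "dy Sg S t"
  shows "E t t"
proof -
  have "dproof Sg S d \<Longrightarrow> dnormal d \<Longrightarrow> E (dconcl d) (dconcl d)" for d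
  proof (induction d)
    case (DCon f ds)
    then show ?case by (auto intro!: E_cons simp: list_all_length)
  next
    case (DAx t)
    then have "aproof Sg S A (Inf REq (AEq t t) [DAx t] [])" by (intro aproof.eq) auto
    then have "good (Inf REq (AEq t t) [DAx t] [])" by (simp add: good_Inf)
    then show ?case unfolding good_concl_def by (metis aprf.sel(2) dconcl.simps(1))
  next
    case (DDes t d ds)
    then have "aproof Sg S A (Inf REq (AEq t t) [DDes t d ds] [])" by (intro aproof.eq) auto
    then have "good (Inf REq (AEq t t) [DDes t d ds] [])" using DDes.prems by (simp add: good_Inf)
    then show ?case unfolding good_concl_def by (metis aprf.sel(2) dconcl.simps(3))
  qed
  then show ?thesis using assms dy_normal by metis
qed

section \<open>Chains of equations and transitivity\<close>

definition step :: "('p, 'f, 'n, 'v) aprf \<Rightarrow> bool" where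
  "step \<pi> \<longleftrightarrow> good \<pi> \<and> last_rule \<pi> \<noteq> RTrans"

definition link :: "('p, 'f, 'n, 'v) aprf \<Rightarrow> ('p, 'f, 'n, 'v) aprf \<Rightarrow> bool" where
  "link \<pi> \<pi>' \<longleftrightarrow> \<not> (last_rule \<pi> = RCons \<and> last_rule \<pi>' = RCons)"

text \<open>The premises of \<open>trans\<close> as a path of nontrivial steps; the empty chain
  stands for identity. The ban on adjacent \<open>cons\<close> steps is kept apart as
  \<open>successively link\<close>, so that chains can be concatenated first and repaired
  afterwards.\<close>

fun chain :: "('f, 'n, 'v) trm \<Rightarrow> ('p, 'f, 'n, 'v) aprf list \<Rightarrow> ('f, 'n, 'v) trm \<Rightarrow> bool" where
  "chain t [] u \<longleftrightarrow> t = u"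
| "chain t (\<pi> # \<pi>s) u \<longleftrightarrow> step \<pi> \<and> (\<exists>v. v \<noteq> t \<and> concl \<pi> = AEq t v \<and> chain v \<pi>s u)"

lemma chain_append: "chain t (\<pi>s @ \<pi>s') v \<longleftrightarrow> (\<exists>u. chain t \<pi>s u \<and> chain u \<pi>s' v)"
  by (induction \<pi>s arbitrary: t) auto

lemma chain_step: "chain t \<pi>s u \<Longrightarrow> \<pi> \<in> set \<pi>s \<Longrightarrow> step \<pi> \<and> (\<forall>a. concl \<pi> \<noteq> AEq a a)"
  by (induction \<pi>s arbitrary: t) auto

lemma chain_holds: "chain t \<pi>s u \<Longrightarrow> app \<tau> t = app \<tau> u"
  by (induction \<pi>s arbitrary: t) (auto simp: step_def good_holds)

lemma chain_nodes:
  "chain t \<pi>s u \<Longrightarrow> \<exists>ts. length ts = Suc (length \<pi>s) \<and> hd ts = t \<and> last ts = u \<and>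
     (\<forall>j<length \<pi>s. concl (\<pi>s ! j) = AEq (ts ! j) (ts ! Suc j))"
proof (induction \<pi>s arbitrary: t)
  case Nil
  then show ?case by (intro HOL.exI[of _ "[t]"]) auto
next
  case (Cons \<pi> \<pi>s)
  then obtain v where v: "concl \<pi> = AEq t v" "chain v \<pi>s u" by auto
  obtain ts where ts: "length ts = Suc (length \<pi>s)" "hd ts = v" "last ts = u"
    "\<forall>j<length \<pi>s. concl (\<pi>s ! j) = AEq (ts ! j) (ts ! Suc j)" using Cons.IH[OF v(2)] by blast
  then have "ts \<noteq> []" by auto
  with v(1) ts show ?case by (intro HOL.exI[of _ "t # ts"]) (auto simp: nth_Cons hd_conv_nth split: nat.splits)
qed

lemma nodes_chain:
  "length ts = Suc (length \<pi>s) \<Longrightarrow> (\<And>j. j < length \<pi>s \<Longrightarrow> concl (\<pi>s ! j) = AEq (ts ! j) (ts ! Suc j)) \<Longrightarrow>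
    (\<And>\<pi>. \<pi> \<in> set \<pi>s \<Longrightarrow> step \<pi> \<and> (\<forall>a. concl \<pi> \<noteq> AEq a a)) \<Longrightarrow> chain (hd ts) \<pi>s (last ts)"
proof (induction \<pi>s arbitrary: ts)
  case Nil
  then show ?case by (auto simp: length_Suc_conv)
next
  case (Cons \<pi> \<pi>s)
  obtain t ts' where ts: "ts = t # ts'" "length ts' = Suc (length \<pi>s)"
    using Cons.prems(1) by (cases ts) auto
  have "concl \<pi> = AEq t (hd ts')" using Cons.prems(2)[of 0] ts by (cases ts') auto
  moreover have "chain (hd ts') \<pi>s (last ts')"
    using Cons.prems(2)[of "Suc _"] Cons.prems(3) ts by (intro Cons.IH) auto
  moreover have "ts' \<noteq> []" using ts by auto
  ultimately show ?case using Cons.prems(3)[of \<pi>] ts by auto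
qed

lemma successively_link:
  "successively link \<pi>s \<longleftrightarrow> (\<forall>j. Suc j < length \<pi>s \<longrightarrow>
     \<not> (last_rule (\<pi>s ! j) = RCons \<and> last_rule (\<pi>s ! Suc j) = RCons))"
proof (induction link \<pi>s rule: successively.induct)
  case (3 \<pi> \<pi>' \<pi>s)
  show ?case unfolding successively.simps 3 by (auto simp: link_def nth_Cons split: nat.splits)
qed auto

lemma good_trans_iff:
  "good (Inf RTrans (AEq t u) [] \<pi>s) \<longleftrightarrow> \<pi>s \<noteq> [] \<and> chain t \<pi>s u \<and> successively link \<pi>s"
proof
  assume g: "good (Inf RTrans (AEq t u) [] \<pi>s)"
  then have "aproof Sg S A (Inf RTrans (AEq t u) [] \<pi>s)" by (simp add: good_def)
  then show "\<pi>s \<noteq> [] \<and> chain t \<pi>s u \<and> successively link \<pi>s"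
  proof cases
    case (trans ts)
    then show ?thesis using g nodes_chain[of ts \<pi>s] by (auto simp: good_Inf successively_link step_def)
  qed
next
  assume *: "\<pi>s \<noteq> [] \<and> chain t \<pi>s u \<and> successively link \<pi>s"
  then obtain ts where ts: "length ts = Suc (length \<pi>s)" "hd ts = t" "last ts = u"
     "\<forall>j<length \<pi>s. concl (\<pi>s ! j) = AEq (ts ! j) (ts ! Suc j)" using chain_nodes by blast
  have st: "\<forall>\<pi>\<in>set \<pi>s. step \<pi> \<and> (\<forall>a. concl \<pi> \<noteq> AEq a a)" using * chain_step by blast
  then have "aproof Sg S A (Inf RTrans (AEq (hd ts) (last ts)) [] \<pi>s)"
    using * ts by (intro aproof.trans) (auto simp: step_def good_def)
  then show "good (Inf RTrans (AEq t u) [] \<pi>s)"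
    using ts st * by (auto simp: good_Inf successively_link[symmetric] step_def)
      (use successively_link in blast)
qed

lemma E_chain:
  assumes "E t u"
  obtains \<pi>s where "chain t \<pi>s u" "successively link \<pi>s"
proof -
  obtain \<pi> where \<pi>: "good \<pi>" "concl \<pi> = AEq t u" using assms good_concl_def by blast
  consider "t = u" | "t \<noteq> u" "step \<pi>" | "last_rule \<pi> = RTrans" using \<pi>(1) by (auto simp: step_def)
  then show ?thesis
  proof cases
    case 1
    then show ?thesis using that[of "[]"] by simp
  next
    case 2
    then show ?thesis using that[of "[\<pi>]"] \<pi>(2) by simp
  next
    case 3
    then obtain ds \<pi>s where eq: "\<pi> = Inf RTrans (AEq t u) ds \<pi>s" using \<pi>(2) by (cases \<pi>) auto
    have "aproof Sg S A (Inf RTrans (AEq t u) ds \<pi>s)" using \<pi>(1) eq by (simp add: good_def)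
    then have "ds = []" by cases auto
    then show ?thesis using \<pi>(1) eq that good_trans_iff by blast
  qed
qed

text \<open>Derivability of \<open>t\<close> serves the empty chain, which is turned into a proof by
  reflexivity.\<close>

lemma chain_E: "chain t \<pi>s u \<Longrightarrow> successively link \<pi>s \<Longrightarrow> dy Sg S t \<Longrightarrow> E t u"
  using good_trans_iff[of t u \<pi>s] E_refl[of t] unfolding good_concl_def
  by (metis aprf.sel(2) chain.simps(1))

text \<open>Two normal chains fail to compose only if \<open>cons\<close> meets \<open>cons\<close>
  at the junction. These two steps merge into one, whose arguments are composed by induction, as the
  arguments of the middle term \<open>u\<close> are smaller.\<close>

lemma E_trans: "E t u \<Longrightarrow> E u v \<Longrightarrow> E t v"
proof (induction u arbitrary: t v rule: measure_induct_rule[of size])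
  case (less u)
  note dy = E_dy(1)[OF less.prems(1)]
  obtain xs where xs: "chain t xs u" "successively link xs" using less.prems(1) by (rule E_chain)
  obtain ys where ys: "chain u ys v" "successively link ys" using less.prems(2) by (rule E_chain)
  show ?case
  proof (cases "successively link (xs @ ys)")
    case True
    then show ?thesis using xs(1) ys(1) dy by (intro chain_E[of t "xs @ ys"]) (auto simp: chain_append)
  next
    case False
    then have ne: "xs \<noteq> []" "ys \<noteq> []" and c: "\<not> link (last xs) (hd ys)"
      using xs(2) ys(2) by (auto simp: successively_append_iff)
    obtain xs' p where xs': "xs = xs' @ [p]" using ne(1) by (cases xs rule: rev_cases) auto
    obtain q ys' where ys': "ys = q # ys'" using ne(2) by (cases ys) auto
    have rules: "last_rule p = RCons" "last_rule q = RCons" using c xs' ys' by (auto simp: link_def)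
    obtain w where w: "chain t xs' w" "good p" "concl p = AEq w u"
      using xs(1) by (auto simp: xs' chain_append step_def)
    obtain z where z: "good q" "concl q = AEq u z" "chain z ys' v"
      using ys(1) by (auto simp: ys' step_def)
    obtain f ws us where 1: "w = Fun f ws" "u = Fun f us" "length ws = ar Sg f" "length us = ar Sg f"
      "\<And>j. j < ar Sg f \<Longrightarrow> E (ws ! j) (us ! j)"
      using good_cons_cases[OF w(2) rules(1) w(3)] by metis
    obtain zs where 2: "z = Fun f zs" "length zs = ar Sg f" "\<And>j. j < ar Sg f \<Longrightarrow> E (us ! j) (zs ! j)"
      using good_cons_cases[OF z(1) rules(2) z(2)] 1(2) by (metis trm.inject(3))
    have "E (ws ! j) (zs ! j)" if "j < ar Sg f" for j
      using less.IH[of "us ! j"] 1 2 that by (simp add: size_nth_termination)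
    then obtain c where c: "good c" "last_rule c = RCons" "concl c = AEq w z"
      using good_cons[of ws f zs] 1 2 by metis
    show ?thesis
    \<comment> \<open>The merged step may be trivial, which \<open>trans\<close> forbids; then it is
      dropped.\<close>
    proof (cases "w = z")
      case True
      \<comment> \<open>In a normal chain the neighbours of a \<open>cons\<close> step are not
        \<open>cons\<close>, so closing the gap creates no forbidden pair.\<close>
      have "successively link (xs' @ ys')"
        using xs(2) ys(2) rules unfolding xs' ys'
        by (auto simp: successively_append_iff successively_Cons link_def)
      then show ?thesis using w z True dy
        by (intro chain_E[of t "xs' @ ys'"]) (auto simp: chain_append)
    next
      case False
      have "successively link (xs' @ c # ys')"
        using xs(2) ys(2) rules c(2) unfolding xs' ys'
        by (auto simp: successively_append_iff successively_Cons link_def)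
      then show ?thesis using w z c False dy
        by (intro chain_E[of t "xs' @ c # ys'"]) (auto simp: chain_append step_def)
    qed
  qed
qed

section \<open>Reversal of proofs and symmetry\<close>

definition flips :: "('p, 'f, 'n, 'v) aprf \<Rightarrow> ('p, 'f, 'n, 'v) aprf \<Rightarrow> bool" where
  "flips \<pi> \<pi>' \<longleftrightarrow> good \<pi>' \<and> (\<forall>t u. concl \<pi> = AEq t u \<longrightarrow> concl \<pi>' = AEq u t) \<and>
     (last_rule \<pi>' = RTrans \<longleftrightarrow> last_rule \<pi> = RTrans) \<and>
     (last_rule \<pi>' = RCons \<longleftrightarrow> last_rule \<pi> = RCons) \<and> (has_cons \<pi>' \<longrightarrow> has_cons \<pi>)"

lemma chain_flip:
  "chain t \<pi>s u \<Longrightarrow> (\<And>\<pi>. \<pi> \<in> set \<pi>s \<Longrightarrow> flips \<pi> (g \<pi>)) \<Longrightarrow> chain u (rev (map g \<pi>s)) t"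
  by (induction \<pi>s arbitrary: t) (force simp: chain_append flips_def step_def)+

text \<open>\<open>sym\<close> is moved to the leaves: it is applied only to \<open>ax\<close> and
  \<open>prom\<close>, an existing \<open>sym\<close> is cancelled, \<open>eq\<close> stays as it
  is, and the other proofs are rebuilt from reversed premises. \<open>flips\<close> records what the
  normality of an enclosing \<open>trans\<close> or \<open>proj\<close> depends on.\<close>

lemma good_flip: "good \<pi> \<Longrightarrow> concl \<pi> = AEq t u \<Longrightarrow> \<exists>\<pi>'. flips \<pi> \<pi>'"
proof (induction \<pi> arbitrary: t u)
  case (Inf r \<gamma> ds \<pi>s)
  note g = Inf.prems(1)[unfolded good_Inf]
  have flip: "\<exists>\<kappa>'. flips \<kappa> \<kappa>'" if "\<kappa> \<in> set \<pi>s" "concl \<kappa> = AEq a b" for \<kappa> a b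
    using Inf.IH that g by blast
  have ap: "aproof Sg S A (Inf r \<gamma> ds \<pi>s)" using g by blast
  then show ?case
  proof cases
    case (ax \<alpha>)
    have "aproof Sg S A (Inf RSym (AEq u t) [] [Inf r \<gamma> ds \<pi>s])"
      using ap Inf.prems by (intro aproof.sym) auto
    then have "good (Inf RSym (AEq u t) [] [Inf r \<gamma> ds \<pi>s])" using Inf.prems(1) ax
      by (simp add: good_Inf)
    then show ?thesis using Inf.prems ax unfolding flips_def
      by (intro HOL.exI[of _ "Inf RSym (AEq u t) [] [Inf r \<gamma> ds \<pi>s]"]) auto
  next
    case (eq d t)
    then show ?thesis using Inf.prems unfolding flips_def
      by (intro HOL.exI[of _ "Inf r \<gamma> ds \<pi>s"]) auto
  next
    case (cons ts f us)
    have "E (us ! j) (ts ! j)" if "j < ar Sg f" for j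
      using flip[of "\<pi>s ! j" "ts ! j" "us ! j"] cons that by (auto simp: flips_def good_concl_def)
    then obtain \<pi>' where "good \<pi>'" "last_rule \<pi>' = RCons" "concl \<pi>' = AEq (Fun f us) (Fun f ts)"
      using good_cons[of us f ts] cons by metis
    then show ?thesis using cons unfolding flips_def by (intro HOL.exI[of _ \<pi>']) auto
  next
    case (sym \<pi> a b)
    then show ?thesis using g unfolding flips_def by (intro HOL.exI[of _ \<pi>]) auto
  next
    case (trans ts)
    have gt: "good (Inf RTrans (AEq t u) [] \<pi>s)" using Inf.prems trans by simp
    then have c: "\<pi>s \<noteq> []" "chain t \<pi>s u" "successively link \<pi>s" using good_trans_iff by blast+
    have "\<exists>\<pi>'. flips (\<pi>s ! j) \<pi>'" if "j < length \<pi>s" for j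
      using flip[of "\<pi>s ! j"] trans(6)[OF that] that by auto
    then have "\<forall>\<pi>\<in>set \<pi>s. \<exists>\<pi>'. flips \<pi> \<pi>'" by (auto simp: in_set_conv_nth)
    then obtain h where h: "\<And>\<pi>. \<pi> \<in> set \<pi>s \<Longrightarrow> flips \<pi> (h \<pi>)" by metis
    have "successively link (rev (map h \<pi>s))"
      using c(3) h by (auto simp: successively_map link_def flips_def elim!: successively_mono)
    then have "good (Inf RTrans (AEq u t) [] (rev (map h \<pi>s)))"
      using c chain_flip[OF c(2), of h] h by (auto simp: good_trans_iff)
    then show ?thesis using h Inf.prems(2) trans unfolding flips_def
      by (intro HOL.exI[of _ "Inf RTrans (AEq u t) [] (rev (map h \<pi>s))"]) auto
  next
    case (proj \<pi> f ts us i)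
    then obtain \<pi>' where \<pi>': "flips \<pi> \<pi>'" using flip by fastforce
    have "aproof Sg S A (Inf RProj (AEq (us ! i) (ts ! i)) [] [\<pi>'])"
      using proj \<pi>' by (intro aproof.proj) (auto simp: flips_def good_def)
    then have "good (Inf RProj (AEq (us ! i) (ts ! i)) [] [\<pi>'])"
      using g proj \<pi>' by (auto simp: good_Inf flips_def)
    then show ?thesis using proj \<pi>' unfolding flips_def
      by (intro HOL.exI[of _ "Inf RProj (AEq (us ! i) (ts ! i)) [] [\<pi>']"]) auto
  next
    case (prom \<pi> a m)
    have "aproof Sg S A (Inf RSym (AEq u t) [] [Inf r \<gamma> ds \<pi>s])"
      using ap Inf.prems by (intro aproof.sym) auto
    then have "good (Inf RSym (AEq u t) [] [Inf r \<gamma> ds \<pi>s])" using Inf.prems(1) prom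
      by (simp add: good_Inf[of RSym])
    then show ?thesis using Inf.prems prom unfolding flips_def
      by (intro HOL.exI[of _ "Inf RSym (AEq u t) [] [Inf r \<gamma> ds \<pi>s]"]) auto
  qed (use g Inf.prems(2) in auto)
qed

lemma E_sym: "E t u \<Longrightarrow> E u t"
  using good_flip unfolding good_concl_def flips_def by blast

section \<open>Projection from chains that may contain cons\<close>

text \<open>A nontrivial step other than \<open>cons\<close> ends in \<open>ax\<close>,
  \<open>prom\<close>, \<open>proj\<close>, or in \<open>sym\<close> over \<open>ax\<close> or
  \<open>prom\<close>. Above \<open>proj\<close> normality forbids \<open>cons\<close>. It might
  hide in the membership proof used by \<open>prom\<close>, but \<open>prom\<close> gives both sides
  a name as value, which is excluded.\<close>

lemma cons_free_step:
  assumes "step \<pi>" "last_rule \<pi> \<noteq> RCons" "concl \<pi> = AEq t u" "t \<noteq> u" "\<forall>m. app \<tau> t \<noteq> Name m"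
  shows "\<not> has_cons \<pi>"
proof -
  have hu: "\<forall>m. app \<tau> u \<noteq> Name m" using good_holds assms by (metis step_def)
  obtain r ds \<pi>s where \<pi>: "\<pi> = Inf r (AEq t u) ds \<pi>s" using assms(3) by (cases \<pi>) auto
  have g: "good (Inf r (AEq t u) ds \<pi>s)" and r: "r \<noteq> RTrans" "r \<noteq> RCons"
    using assms(1,2) \<pi> by (auto simp: step_def)
  note gi = g[unfolded good_Inf]
  then have r': "r \<noteq> RAndE" "r \<noteq> RExE" by auto
  from gi have "aproof Sg S A (Inf r (AEq t u) ds \<pi>s)" by blast
  then show ?thesis
  proof cases
    case (sym \<kappa>)
    obtain r' es \<kappa>s where \<kappa>: "\<kappa> = Inf r' (AEq u t) es \<kappa>s" using sym(5) by (cases \<kappa>) auto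
    have "r' \<in> {RAx, RProm}" and "aproof Sg S A (Inf r' (AEq u t) es \<kappa>s)"
      using gi sym \<kappa> by (auto simp: good_def)
    from this(2,1) show ?thesis
    proof cases
      case (prom \<rho> m)
      then show ?thesis using assms(5) by auto
    qed (use \<pi> sym \<kappa> in auto)
  next
    case (prom \<kappa> m)
    then show ?thesis using hu by auto
  next
    case (proj \<kappa> f ts us i)
    then show ?thesis using gi \<pi> by auto
  qed (use assms(4) r r' \<pi> in auto)
qed

text \<open>Without \<open>cons\<close> there are no forbidden pairs for \<open>trans\<close>, and
  \<open>proj\<close> may be applied to its result. The empty chain makes both terms equal and is
  settled by reflexivity.\<close>

lemma E_proj_cons_free:
  assumes "chain (Fun f ts) \<pi>s (Fun f us)" "\<And>\<pi>. \<pi> \<in> set \<pi>s \<Longrightarrow> \<not> has_cons \<pi>"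
    and "length ts = ar Sg f" "length us = ar Sg f" "i < ar Sg f"
    and "\<And>j. j < ar Sg f \<Longrightarrow> dy Sg S (ts ! j) \<and> dy Sg S (us ! j)"
  shows "E (ts ! i) (us ! i)"
proof (cases "\<pi>s = []")
  case True
  then show ?thesis using assms E_refl by auto
next
  case False
  let ?\<kappa> = "Inf RTrans (AEq (Fun f ts) (Fun f us)) [] \<pi>s"
  have nc: "\<not> has_cons ?\<kappa>" using assms(2) by auto
  have "link \<pi> \<pi>'" if "\<pi> \<in> set \<pi>s" for \<pi> \<pi>'
    using assms(2)[OF that] by (cases \<pi>) (auto simp: link_def)
  then have "successively link \<pi>s" by (intro successively_if_sorted_wrt) (auto simp: sorted_wrt_iff_nth_less)
  then have g: "good ?\<kappa>" using False assms(1) by (simp add: good_trans_iff)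
  have "dy Sg S (Fun f ts)" "dy Sg S (Fun f us)"
    using assms(3,4,6) by (auto intro!: dy_Fun simp: in_set_conv_nth)
  then have "aproof Sg S A (Inf RProj (AEq (ts ! i) (us ! i)) [] [?\<kappa>])"
    using g assms(3-6) by (intro aproof.proj) (auto simp: good_def tabs_child_iff)
  then have "good (Inf RProj (AEq (ts ! i) (us ! i)) [] [?\<kappa>])"
    using g nc by (simp add: good_Inf[of RProj] del: has_cons_Inf)
  then show ?thesis unfolding good_concl_def by (metis aprf.sel(2))
qed

text \<open>The model sends every node of a chain between two terms \<open>f(\<dots>)\<close> to a term with head \<open>f\<close>.
  Hence prom, whose conclusion equates a term with a name, does not occur in the chain, and
  each maximal segment without cons again runs between two terms with head \<open>f\<close>.\<close>

lemma E_proj_chain: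
  assumes "chain v \<pi>s (Fun f us)" "chain (Fun f rs) \<kappa>s v" "\<And>\<pi>. \<pi> \<in> set \<kappa>s \<Longrightarrow> \<not> has_cons \<pi>"
    and "length rs = ar Sg f" "length us = ar Sg f"
    and "\<And>j. j < ar Sg f \<Longrightarrow> E (ts ! j) (rs ! j)" "\<And>j. j < ar Sg f \<Longrightarrow> dy Sg S (us ! j)"
    and "i < ar Sg f"
  shows "E (ts ! i) (us ! i)"
  using assms
\<comment> \<open>The scan keeps in \<open>\<kappa>s\<close> the segment read since the last
  \<open>cons\<close> step, which starts at \<open>Fun f rs\<close>; what came before is already
  projected, as the equations between \<open>ts\<close> and \<open>rs\<close>.\<close>
proof (induction \<pi>s arbitrary: v rs \<kappa>s)
  case Nil
  have "dy Sg S (rs ! j)" if "j < ar Sg f" for j using E_dy(2)[OF Nil.prems(6)[OF that]] .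
  then have "E (rs ! i) (us ! i)"
    using Nil by (intro E_proj_cons_free[of f rs \<kappa>s us]) auto
  then show ?case using Nil.prems(6,8) E_trans by blast
next
  case (Cons \<pi> \<pi>s)
  obtain z where z: "step \<pi>" "concl \<pi> = AEq v z" "v \<noteq> z" "chain z \<pi>s (Fun f us)"
    using Cons.prems(1) by auto
  have hv: "app \<tau> v = Fun f (map (app \<tau>) rs)" using chain_holds[OF Cons.prems(2)] by simp
  show ?case
  proof (cases "last_rule \<pi> = RCons")
    case True
    \<comment> \<open>The value of \<open>v\<close> has head \<open>f\<close>, so this
      \<open>cons\<close> step joins two terms with head \<open>f\<close> and the current segment
      can be projected.\<close>
    obtain vs zs where vz: "v = Fun f vs" "z = Fun f zs" "length vs = ar Sg f" "length zs = ar Sg f"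
      "\<And>j. j < ar Sg f \<Longrightarrow> E (vs ! j) (zs ! j)"
      using good_cons_cases[OF _ True z(2)] z(1) hv by (metis app_simps(2) step_def trm.inject(3))
    have "E (ts ! j) (zs ! j)" if j: "j < ar Sg f" for j
    proof -
      have "dy Sg S (rs ! k) \<and> dy Sg S (vs ! k)" if "k < ar Sg f" for k
        using E_dy(2)[OF Cons.prems(6)[OF that]] E_dy(1)[OF vz(5)[OF that]] by blast
      then have "E (rs ! j) (vs ! j)"
        using Cons.prems(2-4) vz(1,3) j by (intro E_proj_cons_free[of f rs \<kappa>s vs]) auto
      then show ?thesis using Cons.prems(6) vz(5) j E_trans by blast
    qed
    \<comment> \<open>A new, empty segment starts behind the \<open>cons\<close> step, at
      \<open>z\<close>.\<close>
    then show ?thesis using z vz Cons.prems(5,7,8)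
      by (intro Cons.IH[of z zs "[]"]) auto
  next
    case False
    then have "\<not> has_cons \<pi>" using cons_free_step[OF z(1) _ z(2,3)] hv by simp
    then have nc: "\<And>\<kappa>. \<kappa> \<in> set (\<kappa>s @ [\<pi>]) \<Longrightarrow> \<not> has_cons \<kappa>" using Cons.prems(3) by auto
    have "chain (Fun f rs) (\<kappa>s @ [\<pi>]) z" using Cons.prems(2) z(1-3) by (auto simp: chain_append)
    from Cons.IH[OF z(4) this nc Cons.prems(4-8)] show ?thesis .
  qed
qed

lemma E_proj:
  assumes "E (Fun f ts) (Fun f us)" "length ts = ar Sg f" "length us = ar Sg f" "i < ar Sg f"
    and "\<And>j. j < ar Sg f \<Longrightarrow> dy Sg S (ts ! j) \<and> dy Sg S (us ! j)"
  shows "E (ts ! i) (us ! i)"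
proof -
  obtain \<pi>s where "chain (Fun f ts) \<pi>s (Fun f us)" using assms(1) by (rule E_chain)
  then show ?thesis using assms E_refl by (intro E_proj_chain[of _ \<pi>s f us ts "[]" ts]) auto
qed

text \<open>A conclusion of int or wk becomes an admissible premise of int after an application of subst
  with a trivial equation.\<close>

lemma good_mem_int_premise:
  assumes "good_concl (AMem t l)"
  obtains \<pi> where "good \<pi>" "concl \<pi> = AMem t l" "last_rule \<pi> \<notin> {RInt, RWk}"
proof -
  obtain \<pi> where \<pi>: "good \<pi>" "concl \<pi> = AMem t l" using assms good_concl_def by blast
  then have "dy Sg S t" using der_terms_dy[OF good_der] A_dy by fastforce
  then obtain \<kappa> where \<kappa>: "good \<kappa>" "concl \<kappa> = AEq t t" using E_refl good_concl_def by blast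
  have "aproof Sg S A (Inf RSubst (AMem t l) [] [\<pi>, \<kappa>])"
    using \<pi> \<kappa> by (intro aproof.subst) (auto simp: good_def)
  then have "good (Inf RSubst (AMem t l) [] [\<pi>, \<kappa>])" using \<pi> \<kappa> by (simp add: good_Inf)
  then show ?thesis using that by simp
qed

section \<open>Normal proofs for all derivable equations and memberships\<close>

lemma der_good: "der Sg S A \<gamma> \<Longrightarrow> good_concl \<gamma>"
proof (induction rule: der.induct)
  case (der_eq_ax t u)
  then have "aproof Sg S A (Inf RAx (AEq t u) [] [])" by (auto intro: aproof.ax alpha_refl)
  then have "good (Inf RAx (AEq t u) [] [])" by (simp add: good_Inf)
  then show ?case unfolding good_concl_def by (metis aprf.sel(2))
next
  case (der_mem_ax t l)
  then have "aproof Sg S A (Inf RAx (AMem t l) [] [])" by (auto intro: aproof.ax alpha_refl)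
  then have "good (Inf RAx (AMem t l) [] [])" by (simp add: good_Inf)
  then show ?case unfolding good_concl_def by (metis aprf.sel(2))
next
  case (der_refl t)
  then show ?case by (rule E_refl)
next
  case (der_cons ts f us)
  then show ?case by (intro E_cons) auto
next
  case (der_sym t u)
  then show ?case using E_sym by blast
next
  case (der_trans t u v)
  then show ?case by (blast intro: E_trans)
next
  case (der_proj f ts us i)
  then show ?case by (intro E_proj[of f ts us]) auto
next
  case (der_subst t l u)
  then obtain \<pi> \<kappa> where \<pi>: "good \<pi>" "concl \<pi> = AMem t l" "good \<kappa>" "concl \<kappa> = AEq t u"
    using good_concl_def by blast
  then have "aproof Sg S A (Inf RSubst (AMem u l) [] [\<pi>, \<kappa>])"
    by (intro aproof.subst) (auto simp: good_def)
  then have "good (Inf RSubst (AMem u l) [] [\<pi>, \<kappa>])" using \<pi> by (simp add: good_Inf)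
  then show ?case unfolding good_concl_def by (metis aprf.sel(2))
next
  case (der_prom t m)
  then obtain \<pi> where \<pi>: "good \<pi>" "concl \<pi> = AMem t [m]" using good_concl_def by blast
  then have "aproof Sg S A (Inf RProm (AEq t (Name m)) [] [\<pi>])"
    by (intro aproof.prom) (auto simp: good_def)
  then have "good (Inf RProm (AEq t (Name m)) [] [\<pi>])" using \<pi> by (simp add: good_Inf)
  then show ?case unfolding good_concl_def by (metis aprf.sel(2))
next
  case (der_int ls t)
  have "\<forall>l. \<exists>\<pi>. l \<in> set ls \<longrightarrow> good \<pi> \<and> concl \<pi> = AMem t l \<and> last_rule \<pi> \<notin> {RInt, RWk}"
    using der_int.IH good_mem_int_premise by metis
  then obtain g where g: "\<And>l. l \<in> set ls \<Longrightarrow>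
    good (g l) \<and> concl (g l) = AMem t l \<and> last_rule (g l) \<notin> {RInt, RWk}" by metis
  let ?\<pi> = "Inf RInt (AMem t (filter (\<lambda>m. \<forall>l\<in>set ls. m \<in> set l) (hd ls))) [] (map g ls)"
  have "aproof Sg S A ?\<pi>" using der_int.hyps g by (intro aproof.int) (auto simp: good_def)
  then have "good ?\<pi>" using g by (auto simp: good_Inf)
  then show ?case unfolding good_concl_def by (intro HOL.exI[of _ ?\<pi>]) simp
next
  case (der_wk t n l)
  obtain \<pi> where \<pi>: "good \<pi>" "concl \<pi> = AEq t (Name n)" using der_wk.IH(1) good_concl_def by blast
  obtain i where i: "i < length l" "l ! i = n" using der_wk.hyps by (auto simp: in_set_conv_nth)
  have "\<forall>m. \<exists>d. m \<in> set l \<longrightarrow> dproof Sg S d \<and> dconcl d = Name m \<and> dnormal d"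
    using der_wk.hyps dy_normal by metis
  then obtain D where D: "\<And>m. m \<in> set l \<Longrightarrow> dproof Sg S (D m) \<and> dconcl (D m) = Name m \<and> dnormal (D m)"
    by metis
  have "aproof Sg S A (Inf RWk (AMem t l) (map D l) [\<pi>])"
    using \<pi> i D by (intro aproof.wk) (auto simp: good_def)
  then have "good (Inf RWk (AMem t l) (map D l) [\<pi>])" using \<pi> D by (auto simp: good_Inf list_all_iff)
  then show ?case unfolding good_concl_def by (metis aprf.sel(2))
qed

end


section \<open>Typed proofs\<close>

text \<open>\<open>C\<close> stands for the subterms of the kernels, \<open>V\<close> for the
  quantified variables and \<open>\<tau>\<close> for \<open>\<omega>\<close>. As
  \<open>\<tau>\<close> absorbs \<open>\<sigma>\<close> and itself, values of typed terms can be
  traced back to \<open>C\<close>; \<open>V_C\<close> covers the quantified variables that the model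
  moves.\<close>

locale typed_model = eq_model Sg S A \<tau>
  for Sg :: "('f, 'n, 'v) sys" and S :: "('f, 'n, 'v) trm set"
    and A :: "('p, 'f, 'n, 'v) asrt set" and \<tau> :: "('f, 'n, 'v) sub" +
  fixes C :: "('f, 'n, 'v) trm set" and V :: "'v set" and \<sigma> :: "('f, 'n, 'v) sub"
    and Ty :: "('f, 'n, 'v) trm set"
  assumes Ty_def: "Ty = app \<sigma> ` (C - range Var) \<union> app \<tau> ` C \<union> Var ` V"
    and C_args: "Fun f ts \<in> C \<Longrightarrow> t \<in> set ts \<Longrightarrow> t \<in> C"
    and \<sigma>_C: "t \<in> C \<Longrightarrow> app \<sigma> t \<in> Ty"
    and \<tau>_\<sigma>: "app \<tau> (app \<sigma> t) = app \<tau> t"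
    and \<tau>_\<tau>: "app \<tau> (app \<tau> t) = app \<tau> t"
    and V_C: "x \<in> V \<Longrightarrow> app \<tau> (Var x) = Var x \<or> Var x \<in> C"
    and A_eq_typed: "AEq t u \<in> A \<Longrightarrow> t \<in> Ty \<and> u \<in> Ty"
    and A_mem_typed: "AMem t l \<in> A \<Longrightarrow> t \<in> Ty"
begin

lemma Ty_cases:
  assumes "t \<in> Ty"
  obtains r where "r \<in> C" "t = app \<sigma> r" "r \<notin> range Var" | r where "r \<in> C" "t = app \<tau> r"
    | x where "x \<in> V" "t = Var x"
  using assms by (auto simp: Ty_def)

lemma \<tau>_C: "t \<in> C \<Longrightarrow> app \<tau> t \<in> Ty"
  by (auto simp: Ty_def)

text \<open>For \<open>prom\<close>, which puts the name itself into an equation. A typed term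
  either is its own value, or its value is the instance under \<open>\<tau>\<close> of a term in
  \<open>C\<close>.\<close>

lemma Ty_name:
  assumes "t \<in> Ty" "app \<tau> t = Name m"
  shows "t = Name m \<or> Name m \<in> Ty"
  using assms(1)
proof (cases rule: Ty_cases)
  case (1 r)
  then show ?thesis using assms(2) \<tau>_\<sigma> \<tau>_C by metis
next
  case (2 r)
  then show ?thesis using assms \<tau>_\<tau> by metis
next
  case (3 x)
  then show ?thesis using assms(2) V_C \<tau>_C by (metis trm.distinct(1))
qed

text \<open>If both sides were instances under \<open>\<tau>\<close>, they would be equal, \<open>\<tau>\<close> being idempotent;
  so one of them is \<open>app \<sigma> r\<close> for a compound \<open>r\<close>, which also equals the other one under \<open>\<tau>\<close>.\<close>

lemma Ty_args:
  assumes "Fun f ts \<in> Ty" "Fun f us \<in> Ty" "app \<tau> (Fun f ts) = app \<tau> (Fun f us)"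
    and "Fun f ts \<noteq> Fun f us"
  shows "set ts \<subseteq> Ty"
  using assms(1)
proof (cases rule: Ty_cases)
  case (1 r)
  then obtain rs where "r = Fun f rs" "ts = map (app \<sigma>) rs" by (cases r) auto
  then show ?thesis using 1(1) C_args \<sigma>_C by auto
next
  case (2 r)
  have eq: "Fun f ts = app \<tau> (Fun f us)" using 2(2) assms(3) \<tau>_\<tau> by metis
  from assms(2) show ?thesis
  proof (cases rule: Ty_cases)
    case (1 q)
    then obtain qs where q: "q = Fun f qs" by (cases q) auto
    have "Fun f ts = app \<tau> q" using eq 1(2) \<tau>_\<sigma> by metis
    then show ?thesis using q 1(1) C_args \<tau>_C by auto
  next
    case (2 q)
    then show ?thesis using eq assms(4) \<tau>_\<tau> by metis
  qed auto
qed auto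

lemma chain_typed:
  "chain t \<pi>s u \<Longrightarrow> \<pi>s \<noteq> [] \<Longrightarrow>
    (\<And>\<pi> a b. \<pi> \<in> set \<pi>s \<Longrightarrow> concl \<pi> = AEq a b \<Longrightarrow> a = b \<or> a \<in> Ty \<and> b \<in> Ty) \<Longrightarrow> t \<in> Ty \<and> u \<in> Ty"
proof (induction \<pi>s arbitrary: t)
  case (Cons \<pi> \<pi>s)
  then obtain v where v: "concl \<pi> = AEq t v" "v \<noteq> t" "chain v \<pi>s u" by auto
  have tv: "t \<in> Ty \<and> v \<in> Ty" using Cons.prems(3)[of \<pi> t v] v by auto
  show ?case
  proof (cases "\<pi>s = []")
    case True
    then show ?thesis using tv v by simp
  next
    case False
    then show ?thesis using tv Cons.IH[OF v(3)] Cons.prems(3) by (metis list.set_intros(2))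
  qed
qed simp

text \<open>Memberships are carried along because \<open>prom\<close> turns them into equations.
  Their left-hand side may also be an untyped name, as \<open>wk\<close> applies to trivial
  equations between names; \<open>prom\<close> leads from there only to trivial equations.\<close>

lemma good_typed:
  "good \<pi> \<Longrightarrow> \<not> has_cons \<pi> \<Longrightarrow> (\<forall>t u. concl \<pi> = AEq t u \<longrightarrow> t = u \<or> t \<in> Ty \<and> u \<in> Ty) \<and>
     (\<forall>t l. concl \<pi> = AMem t l \<longrightarrow> t \<in> Ty \<or> t \<in> range Name)"
proof (induction \<pi>)
  case (Inf r \<gamma> ds \<pi>s)
  note g = Inf.prems(1)[unfolded good_Inf]
  have eqs: "a = b \<or> a \<in> Ty \<and> b \<in> Ty" if "\<kappa> \<in> set \<pi>s" "concl \<kappa> = AEq a b" for \<kappa> a b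
    using Inf.IH[OF that(1)] Inf.prems(2) g that by auto
  have mems: "a \<in> Ty \<or> a \<in> range Name" if "\<kappa> \<in> set \<pi>s" "concl \<kappa> = AMem a l" for \<kappa> a l
    using Inf.IH[OF that(1)] Inf.prems(2) g that by auto
  have ap: "aproof Sg S A (Inf r \<gamma> ds \<pi>s)" using g by blast
  then show ?case
  proof cases
    case (ax \<alpha>)
    then have "\<gamma> = AEq t u \<Longrightarrow> AEq t u \<in> A" "\<gamma> = AMem t l \<Longrightarrow> AMem t l \<in> A" for t u l
      using alpha_AEq_iff[of \<alpha> \<gamma> t u] alpha_AMem_iff[of \<alpha> \<gamma> t l] by auto
    then show ?thesis using A_eq_typed A_mem_typed by auto
  next
    case (sym \<kappa> a b)
    then show ?thesis using eqs[of \<kappa> a b] by auto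
  next
    case (trans ts)
    then have "good (Inf RTrans (AEq (hd ts) (last ts)) [] \<pi>s)" using Inf.prems(1) by simp
    then have "chain (hd ts) \<pi>s (last ts)" "\<pi>s \<noteq> []" using good_trans_iff by blast+
    then show ?thesis using chain_typed eqs trans by auto
  next
    case (proj \<kappa> f ts us i)
    have \<kappa>: "good \<kappa>" using g proj by simp
    \<comment> \<open>A trivial premise projects to a trivial equation; for a nontrivial one
      \<open>Ty_args\<close> is applied in both directions.\<close>
    have "Fun f ts = Fun f us \<or> set ts \<subseteq> Ty \<and> set us \<subseteq> Ty"
      using eqs[of \<kappa> "Fun f ts" "Fun f us"] proj Ty_args[of f ts us] Ty_args[of f us ts]
        good_holds[OF \<kappa>, of "Fun f ts" "Fun f us"] by auto
    then show ?thesis using proj by (auto dest: nth_mem)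
  next
    case (subst \<kappa> a l \<kappa>' b)
    then show ?thesis using mems[of \<kappa> a l] eqs[of \<kappa>' a b] by auto
  next
    case (prom \<kappa> a m)
    have "app \<tau> a = Name m" using good_mem_holds[of \<kappa> a "[m]"] g prom by auto
    then show ?thesis using mems[of \<kappa> a "[m]"] Ty_name[of a m] prom by auto
  next
    case (int ts a)
    then have "hd \<pi>s \<in> set \<pi>s" "concl (hd \<pi>s) = AMem a (ts ! 0)" by (auto simp: hd_conv_nth)
    then show ?thesis using mems[of "hd \<pi>s" a "ts ! 0"] int by auto
  next
    case (wk \<kappa> a l i)
    then show ?thesis using eqs[of \<kappa> a "Name (l ! i)"] by auto
  qed (use g Inf.prems(2) in auto)
qed

lemma good_subproofs: "good \<pi> \<Longrightarrow> \<rho> \<in> subproofs \<pi> \<Longrightarrow> good \<rho>"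
  by (induction \<pi>) (auto simp: good_Inf)

lemma typed_normal_proof:
  assumes "eq_deriv Sg (S, A) (AEq a b)"
  shows "\<exists>\<pi>. eq_proof Sg (S, A) (AEq a b) \<pi> \<and> normal \<pi> \<and> typed_proof Ty \<pi>"
proof -
  have "der Sg S A (AEq a b)" using assms eq_deriv_der by fastforce
  then obtain \<pi> where \<pi>: "good \<pi>" "concl \<pi> = AEq a b" using der_good good_concl_def by blast
  \<comment> \<open>Subproofs of good proofs are good, so \<open>good_typed\<close> covers each one
    without \<open>cons\<close>.\<close>
  moreover have "typed_proof Ty \<pi>"
    unfolding typed_proof_def using good_typed good_subproofs[OF \<pi>(1)] by blast
  ultimately show ?thesis by (auto simp: good_def eq_proof_def eq_only_def)
qed

end


section \<open>The model given by a run\<close>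

lemma app_Var: "app \<tau> (Var x) = (case \<tau> x of None \<Rightarrow> Var x | Some t \<Rightarrow> t)"
  by (simp add: app_def)

lemma app_scomp: "app (scomp \<tau> \<tau>') t = app \<tau> (app \<tau>' t)"
  by (induction t) (auto simp: app_Var scomp_def split: option.splits)

lemma app_cong: "(\<And>x. x \<in> vars t \<Longrightarrow> app \<tau> (Var x) = app \<tau>' (Var x)) \<Longrightarrow> app \<tau> t = app \<tau>' t"
  by (induction t) auto

lemma app_id: "(\<And>x. x \<in> vars t \<Longrightarrow> app \<tau> (Var x) = Var x) \<Longrightarrow> app \<tau> t = t"
  by (induction t) (auto intro: map_idI)

lemma app_not_dom: "x \<notin> dom \<nu> \<Longrightarrow> app \<nu> (Var x) = Var x"
  by (auto simp: app_Var split: option.splits)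

lemma app_absorb: "(\<And>x. app \<rho> (app \<nu> (Var x)) = app \<rho> (Var x)) \<Longrightarrow> app \<rho> (app \<nu> t) = app \<rho> t"
  by (induction t) auto

lemma wf_trm_app: "(\<And>t. t \<in> ran \<tau> \<Longrightarrow> wf_trm a t) \<Longrightarrow> wf_trm a t \<Longrightarrow> wf_trm a (app \<tau> t)"
  by (induction t) (auto simp: app_Var ran_def list_all_iff split: option.splits)

text \<open>A destructor returns an argument of its major premise, so term proofs never introduce
  variables.\<close>

lemma dproof_vars:
  "dy_system Sg \<Longrightarrow> dproof Sg S d \<Longrightarrow> vars (dconcl d) \<subseteq> (\<Union>s\<in>S. vars s)"
proof (induction d)
  case (DAx t)
  then show ?case by auto
next
  case (DCon f ds)
  then show ?case by (fastforce simp: list_all_iff)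
next
  case (DDes t d ds)
  then obtain f ls us i s where r: "(f, ls, us, i) \<in> destr Sg" "dconcl d = Fun f (map (tsubst s) ls)"
    "t = tsubst s (ls ! i)" unfolding dproof.simps by blast
  have "i < length ls" using r(1) DDes.prems(1) unfolding dy_system_def by auto
  then have "ls ! i \<in> set ls" by simp
  then have "vars t \<subseteq> vars (dconcl d)" using r(2,3) by auto
  then show ?case using DDes by auto
qed

lemma dy_vars: "dy_system Sg \<Longrightarrow> dy Sg S t \<Longrightarrow> vars t \<subseteq> (\<Union>s\<in>S. vars s)"
  using dproof_vars unfolding dy_def by metis

lemma wf_asrt_bv: "wf_asrt Sg \<alpha> \<Longrightarrow> bv \<alpha> \<subseteq> qvars Sg"
  by (induction \<alpha>) (auto simp: bv_def)

lemma tpubs_vars: "s \<in> tpubs V t \<Longrightarrow> vars s \<inter> V = {}"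
  by (induction t) (auto split: if_splits)

lemma tpubs_wf: "s \<in> tpubs V t \<Longrightarrow> wf_trm a t \<Longrightarrow> wf_trm a s"
  by (induction t) (auto simp: list_all_iff split: if_splits)

lemma pubs_vars: "s \<in> pubs Sg \<alpha> \<Longrightarrow> vars s \<inter> qvars Sg = {}"
  by (induction \<alpha>) (auto dest: tpubs_vars simp del: tpubs.simps)

lemma atomic_wf_trm: "atomic_trm t \<Longrightarrow> wf_trm a t"
  by (cases t) auto

lemma pubs_wf:
  assumes "ar Sg (pk Sg) = 1"
  shows "s \<in> pubs Sg \<alpha> \<Longrightarrow> wf_asrt Sg \<alpha> \<Longrightarrow> wf_trm (ar Sg) s"
proof (induction \<alpha>)
  case (ASays k \<alpha>)
  have "wf_trm (ar Sg) (Fun (pk Sg) [k])" using ASays.prems(2) assms by simp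
  from tpubs_wf[OF _ this] show ?case using ASays by (auto simp del: tpubs.simps wf_trm.simps)
qed (auto simp: list_all_iff intro: tpubs_wf atomic_wf_trm)

text \<open>The term is rebuilt by constructors from its maximal subterms without variables of
  \<open>V\<close> and from its variables in \<open>V\<close>, all of whose instances are
  given.\<close>

lemma dy_app_tpubs:
  assumes "wf_trm (ar Sg) t" "app \<tau> ` tpubs V t \<subseteq> S" "\<And>x. x \<in> vars t \<inter> V \<Longrightarrow> app \<tau> (Var x) \<in> S"
  shows "dy Sg S (app \<tau> t)"
  using assms
proof (induction t)
  case (Fun f ts)
  show ?case
  proof (cases "vars (Fun f ts) \<inter> V = {}")
    case True
    then show ?thesis using Fun.prems(2) by (auto intro: dy_ax)
  next
    case False
    have "dy Sg S (app \<tau> t)" if t: "t \<in> set ts" for t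
    proof (rule Fun.IH[OF t])
      show "app \<tau> (Var x) \<in> S" if "x \<in> vars t \<inter> V" for x using Fun.prems(3)[of x] that t by auto
    qed (use Fun.prems False t in \<open>auto simp: list_all_iff\<close>)
    then show ?thesis using Fun.prems(1) by (auto intro!: dy_Fun)
  qed
qed (auto intro!: dy_ax split: if_splits)

lemma atoms_AEq:
  "AEq t u \<in> atoms \<alpha> \<Longrightarrow> wf_asrt Sg \<alpha> \<Longrightarrow> wf_trm (ar Sg) t \<and> wf_trm (ar Sg) u \<and>
     tpubs (qvars Sg) t \<union> tpubs (qvars Sg) u \<subseteq> pubs Sg \<alpha> \<and> vars t \<union> vars u \<subseteq> fv \<alpha> \<union> bv \<alpha>"
  by (induction \<alpha>) (auto simp: bv_def)

lemma atoms_AMem: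
  "AMem t l \<in> atoms \<alpha> \<Longrightarrow> wf_asrt Sg \<alpha> \<Longrightarrow> wf_trm (ar Sg) t \<and>
     tpubs (qvars Sg) t \<union> Name ` set l \<subseteq> pubs Sg \<alpha> \<and> vars t \<subseteq> fv \<alpha> \<union> bv \<alpha>"
  by (induction \<alpha>) (auto simp: bv_def intro: atomic_wf_trm)

text \<open>Free variables of \<open>\<alpha>\<close> are not quantified, so the quantified
  variables of its equations and memberships are bound in \<open>\<alpha>\<close>, and their
  instances lie in \<open>S\<close> like those of the public terms.\<close>

lemma dy_app_atoms:
  assumes "wf_asrt Sg \<alpha>" "\<gamma> \<in> atoms \<alpha>" "fv \<alpha> \<inter> qvars Sg = {}"
    and "app \<tau> ` (pubs Sg \<alpha> \<union> Var ` bv \<alpha>) \<subseteq> S"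
  shows "terms_dy Sg S (asub \<tau> \<gamma>)"
proof -
  have dy: "dy Sg S (app \<tau> t)"
    if "wf_trm (ar Sg) t" "tpubs (qvars Sg) t \<subseteq> pubs Sg \<alpha>" "vars t \<subseteq> fv \<alpha> \<union> bv \<alpha>" for t
    using that assms(3,4) by (intro dy_app_tpubs[of _ _ _ "qvars Sg"]) blast+
  show ?thesis
  proof (cases \<gamma>)
    case (AEq t u)
    then show ?thesis using atoms_AEq[of t u \<alpha> Sg] assms(1,2) dy by auto
  next
    case (AMem t l)
    then have "app \<tau> (Name m) \<in> S" if "m \<in> set l" for m
      using atoms_AMem[of t l \<alpha> Sg] assms that by blast
    then show ?thesis using AMem atoms_AMem[of t l \<alpha> Sg] assms(1,2) dy by (auto intro: dy_ax)
  qed auto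
qed

text \<open>Introductions do not produce equations or memberships, so these must be among the
  witnesses. A says-atom is left out, since it may be assembled from its body.\<close>

lemma assembles_atoms: "assembles Z \<alpha> \<Longrightarrow> \<gamma> \<in> atoms \<alpha> \<Longrightarrow> is_eqn \<gamma> \<Longrightarrow> \<gamma> \<in> Z"
  by (induction \<alpha>) auto

lemma holds_asub:
  "(\<And>t. app \<tau> (app \<rho> t) = app \<tau> t) \<Longrightarrow> holds \<tau> (asub \<rho> \<gamma>) \<longleftrightarrow> holds \<tau> \<gamma>"
  by (cases \<gamma>) auto

lemma asub_is_eqn: "is_eqn (asub \<rho> \<gamma>) \<longleftrightarrow> is_eqn \<gamma>"
  by (cases \<gamma>) auto

lemma holds_not_eqn: "\<not> is_eqn \<gamma> \<Longrightarrow> holds \<tau> \<gamma>"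
  by (cases \<gamma>) auto

lemma ksub_ker:
  "ksub \<sigma> (ker (S, A)) = (app \<sigma> ` (S \<union> Var ` (\<Union>\<alpha>\<in>A. bv \<alpha>)), asub \<sigma> ` (\<Union>\<alpha>\<in>A. atoms \<alpha>))"
  by (simp add: ksub_def ker_def)

text \<open>The instance derived by the witness holds because the kernel does. As
  \<open>\<tau>\<close> absorbs \<open>\<sigma>\<close> and \<open>\<nu>\<close>, the instance is
  true exactly if the atom itself is.\<close>

lemma witness_holds:
  assumes "witness Sg \<sigma> (ker k) \<beta> Z \<nu>" "\<And>\<alpha> \<gamma>. \<alpha> \<in> snd k \<Longrightarrow> \<gamma> \<in> atoms \<alpha> \<Longrightarrow> holds \<tau> \<gamma>"
    and "\<And>t. app \<tau> (app \<sigma> t) = app \<tau> t" "\<And>t. app \<tau> (app \<nu> t) = app \<tau> t" "\<gamma> \<in> atoms \<beta>"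
  shows "holds \<tau> \<gamma>"
proof (cases "is_eqn \<gamma>")
  case True
  obtain S A where k: "k = (S, A)" by (cases k)
  have "\<gamma> \<in> Z" using assms(1,5) True assembles_atoms by (auto simp: witness_def)
  then have "eq_deriv Sg (ksub \<sigma> (ker k)) (asub (scomp \<sigma> \<nu>) \<gamma>)" using assms(1) by (auto simp: witness_def)
  then have "der Sg (app \<sigma> ` (S \<union> Var ` (\<Union>\<alpha>\<in>A. bv \<alpha>))) (asub \<sigma> ` (\<Union>\<alpha>\<in>A. atoms \<alpha>)) (asub (scomp \<sigma> \<nu>) \<gamma>)"
    using True eq_deriv_der asub_is_eqn unfolding k ksub_ker by blast
  then have "holds \<tau> (asub (scomp \<sigma> \<nu>) \<gamma>)"
    by (rule der_holds) (use assms(2,3) holds_asub k in force)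
  then show ?thesis using holds_asub[of \<tau> "scomp \<sigma> \<nu>" \<gamma>] assms(3,4) by (simp add: app_scomp)
qed (rule holds_not_eqn)

lemma st_args: "Fun f ts \<in> st t \<Longrightarrow> u \<in> set ts \<Longrightarrow> u \<in> st t"
proof (induction t)
  case (Fun g us)
  have "u \<in> st u" by (cases u) auto
  then show ?case using Fun by auto
qed auto

lemma st_refl: "t \<in> st t"
  by (cases t) auto

lemma ast_args: "Fun f ts \<in> ast Sg \<alpha> \<Longrightarrow> u \<in> set ts \<Longrightarrow> u \<in> ast Sg \<alpha>"
proof (induction \<alpha>)
  case (ASays k \<alpha>)
  then show ?case using st_args[of f ts "Fun (pk Sg) [k]" u] by (auto simp del: st.simps)
qed (auto intro: st_args)

lemma know_st_args: "Fun f ts \<in> know_st Sg k \<Longrightarrow> u \<in> set ts \<Longrightarrow> u \<in> know_st Sg k"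
  by (auto simp: know_st_def split: prod.splits intro: st_args ast_args)

section \<open>Actions and binders of a run\<close>

lemma session_action:
  assumes "session Sg Pr s" "(u, \<beta>, \<alpha>) \<in> set s"
  shows "u \<in> agents Sg \<and> wf_asrt Sg \<beta> \<and> wf_asrt Sg \<alpha>"
proof -
  obtain j where "j < length s" "s ! j = (u, \<beta>, \<alpha>)" using assms(2) by (auto simp: in_set_conv_nth)
  then show ?thesis using assms(1) unfolding session_def by (auto split: prod.splits)
qed

lemma interleaving_mem:
  assumes "interleaving Ss \<xi>" "i < length \<xi>"
  obtains s where "s \<in> Ss" "\<xi> ! i \<in> set s"
proof -
  obtain lab where lab: "\<forall>i<length \<xi>. lab i \<in> Ss"
    "\<forall>s\<in>Ss. map ((!) \<xi>) (filter (\<lambda>i. lab i = s) [0..<length \<xi>]) = s"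
    using assms(1) unfolding interleaving_def by blast
  have "\<xi> ! i \<in> set (map ((!) \<xi>) (filter (\<lambda>k. lab k = lab i) [0..<length \<xi>]))"
    using assms(2) by auto
  then show ?thesis using that lab assms(2) by metis
qed

lemma act_binders_take_Suc:
  "i < length \<xi> \<Longrightarrow> act_binders (take (Suc i) \<xi>) =
     act_binders (take i \<xi>) @ binders (recv \<xi> (Suc i)) @ binders (sent \<xi> (Suc i))"
  by (simp add: act_binders_def take_Suc_conv_app_nth recv_def sent_def split: prod.splits)

lemma distinct_act_binders_take: "distinct (act_binders \<xi>) \<Longrightarrow> distinct (act_binders (take i \<xi>))"
  by (metis act_binders_def append_take_drop_id concat_append distinct_append map_append)

locale run_setting =
  fixes Sg :: "('f, 'n, 'v) sys"
    and Pr :: "('p, 'f, 'n, 'v) role set"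
    and init :: "'n \<Rightarrow> ('f, 'n, 'v) trm set"
    and \<xi> :: "('p, 'f, 'n, 'v) action list"
    and \<sigma> :: "('f, 'n, 'v) sub"
    and K :: "nat \<Rightarrow> 'n \<Rightarrow> ('p, 'f, 'n, 'v) know"
    and X Y :: "nat \<Rightarrow> ('p, 'f, 'n, 'v) asrt set"
    and \<mu> \<theta> :: "nat \<Rightarrow> ('f, 'n, 'v) sub"
  assumes dy_system: "dy_system Sg"
    and run: "run Sg Pr init \<xi> \<sigma> K"
    and witness_recv: "1 \<le> j \<Longrightarrow> j \<le> length \<xi> \<Longrightarrow>
           witness Sg \<sigma> (ker (K (j - 1) (intruder Sg))) (recv \<xi> j) (X j) (\<mu> j)"
    and witness_sent: "1 \<le> j \<Longrightarrow> j \<le> length \<xi> \<Longrightarrow>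
           witness Sg \<sigma> (ker (K j (actor \<xi> j))) (sent \<xi> j) (Y j) (\<theta> j)"
begin

abbreviation I :: 'n where "I \<equiv> intruder Sg"

abbreviation Q :: "'v set" where "Q \<equiv> qvars Sg"

abbreviation \<omega> :: "nat \<Rightarrow> ('f, 'n, 'v) trm \<Rightarrow> ('f, 'n, 'v) trm" where
  "\<omega> i \<equiv> app (omega \<sigma> \<mu> \<theta> i)"

lemma intruder_agent: "I \<in> agents Sg"
  using dy_system unfolding dy_system_def by blast

lemma dom_\<sigma>: "dom \<sigma> = act_fv \<xi>"
  using run unfolding run_def by blast

lemma ran_\<sigma>: "t \<in> ran \<sigma> \<Longrightarrow> wf_trm (ar Sg) t \<and> vars t = {}"
  using run unfolding run_def by blast

lemma act_fv_Q: "act_fv \<xi> \<inter> Q = {}"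
  using run unfolding run_def by blast

lemma init_terms: "a \<in> agents Sg \<Longrightarrow> t \<in> init a \<Longrightarrow> wf_trm (ar Sg) t \<and> vars t \<inter> Q = {}"
  using run unfolding run_def by blast

lemma K_0: "a \<in> agents Sg \<Longrightarrow> K 0 a = (init a, {})"
  using run unfolding run_def by blast

text \<open>Actions are numbered from 1: \<open>Suc i\<close> is the action at list index
  \<open>i\<close>, and \<open>K i\<close> is the state before it.\<close>

lemma K_step:
  assumes "i < length \<xi>"
  shows "a \<in> agents Sg \<Longrightarrow> a \<noteq> actor \<xi> (Suc i) \<Longrightarrow> a \<noteq> I \<Longrightarrow> K (Suc i) a = K i a"
    and "K (Suc i) (actor \<xi> (Suc i)) = update Sg (K i (actor \<xi> (Suc i))) (recv \<xi> (Suc i))"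
    and "K (Suc i) I = update Sg (K i I) (sent \<xi> (Suc i))"
proof -
  have "Suc i \<in> {1..length \<xi>}" using assms by simp
  moreover have "\<forall>i\<in>{1..length \<xi>}.
        (\<forall>a\<in>agents Sg - {actor \<xi> i, I}. K i a = K (i - 1) a) \<and>
        K i (actor \<xi> i) = update Sg (K (i - 1) (actor \<xi> i)) (recv \<xi> i) \<and>
        K i I = update Sg (K (i - 1) I) (sent \<xi> i)"
    using run unfolding run_def by blast
  ultimately have *: "(\<forall>a\<in>agents Sg - {actor \<xi> (Suc i), I}. K (Suc i) a = K i a) \<and>
      K (Suc i) (actor \<xi> (Suc i)) = update Sg (K i (actor \<xi> (Suc i))) (recv \<xi> (Suc i)) \<and>
      K (Suc i) I = update Sg (K i I) (sent \<xi> (Suc i))" by fastforce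
  show "a \<in> agents Sg \<Longrightarrow> a \<noteq> actor \<xi> (Suc i) \<Longrightarrow> a \<noteq> I \<Longrightarrow> K (Suc i) a = K i a"
    "K (Suc i) (actor \<xi> (Suc i)) = update Sg (K i (actor \<xi> (Suc i))) (recv \<xi> (Suc i))"
    "K (Suc i) I = update Sg (K i I) (sent \<xi> (Suc i))"
    using * by blast+
qed

lemma action:
  assumes "i < length \<xi>"
  shows "actor \<xi> (Suc i) \<in> agents Sg" "wf_asrt Sg (recv \<xi> (Suc i))" "wf_asrt Sg (sent \<xi> (Suc i))"
proof -
  obtain Ss where Ss: "\<forall>s\<in>Ss. session Sg Pr s" "interleaving Ss \<xi>"
    using run unfolding run_def by blast
  obtain s where s: "s \<in> Ss" "\<xi> ! i \<in> set s" using interleaving_mem[OF Ss(2) assms] .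
  obtain u \<beta> \<alpha> where "\<xi> ! i = (u, \<beta>, \<alpha>)" by (cases "\<xi> ! i")
  then show "actor \<xi> (Suc i) \<in> agents Sg" "wf_asrt Sg (recv \<xi> (Suc i))" "wf_asrt Sg (sent \<xi> (Suc i))"
    using session_action[of Sg Pr s u \<beta> \<alpha>] Ss(1) s by (auto simp: actor_def recv_def sent_def)
qed

lemma action_fv:
  assumes "i < length \<xi>"
  shows "fv (recv \<xi> (Suc i)) \<inter> Q = {}" "fv (sent \<xi> (Suc i)) \<inter> Q = {}"
proof -
  have "\<xi> ! i \<in> set \<xi>" using assms by simp
  then have "fv (recv \<xi> (Suc i)) \<union> fv (sent \<xi> (Suc i)) \<subseteq> act_fv \<xi>"
    by (force simp: act_fv_def role_fv_def recv_def sent_def)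
  then show "fv (recv \<xi> (Suc i)) \<inter> Q = {}" "fv (sent \<xi> (Suc i)) \<inter> Q = {}" using act_fv_Q by auto
qed

text \<open>All binders of the run are distinct, so each action binds variables that are new to the
  earlier ones; this stratifies the domains of the \<open>\<mu>\<close> and
  \<open>\<theta>\<close>.\<close>

definition B :: "nat \<Rightarrow> 'v set" where
  "B i = set (act_binders (take i \<xi>))"

lemma B_0: "B 0 = {}"
  by (simp add: B_def act_binders_def)

lemma B_Suc:
  assumes "i < length \<xi>"
  shows "B (Suc i) = B i \<union> bv (recv \<xi> (Suc i)) \<union> bv (sent \<xi> (Suc i))"
    and "B i \<inter> bv (recv \<xi> (Suc i)) = {}" "B i \<inter> bv (sent \<xi> (Suc i)) = {}"
    and "bv (recv \<xi> (Suc i)) \<inter> bv (sent \<xi> (Suc i)) = {}"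
proof -
  have "distinct (act_binders \<xi>)" using run unfolding run_def by blast
  from distinct_act_binders_take[OF this, of "Suc i"]
  show "B (Suc i) = B i \<union> bv (recv \<xi> (Suc i)) \<union> bv (sent \<xi> (Suc i))"
    and "B i \<inter> bv (recv \<xi> (Suc i)) = {}" "B i \<inter> bv (sent \<xi> (Suc i)) = {}"
    and "bv (recv \<xi> (Suc i)) \<inter> bv (sent \<xi> (Suc i)) = {}"
    using assms by (auto simp: B_def bv_def act_binders_take_Suc)
qed

section \<open>Knowledge along the run\<close>

definition msgs :: "nat \<Rightarrow> ('p, 'f, 'n, 'v) asrt set" where
  "msgs i = (\<Union>j<i. {recv \<xi> (Suc j), sent \<xi> (Suc j)})"

lemma msgs_Suc: "msgs (Suc i) = insert (recv \<xi> (Suc i)) (insert (sent \<xi> (Suc i)) (msgs i))"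
  by (auto simp: msgs_def less_Suc_eq)

lemma msgs_wf: "i \<le> length \<xi> \<Longrightarrow> \<alpha> \<in> msgs i \<Longrightarrow> wf_asrt Sg \<alpha> \<and> fv \<alpha> \<inter> Q = {} \<and> bv \<alpha> \<subseteq> Q"
proof -
  assume i: "i \<le> length \<xi>" and "\<alpha> \<in> msgs i"
  then obtain j where "j < i" "\<alpha> = recv \<xi> (Suc j) \<or> \<alpha> = sent \<xi> (Suc j)"
    unfolding msgs_def by blast
  moreover from this i have "j < length \<xi>" by simp
  ultimately show ?thesis using action(2,3)[of j] action_fv[of j] wf_asrt_bv by blast
qed

lemma msgs_B: "i \<le> length \<xi> \<Longrightarrow> \<alpha> \<in> msgs i \<Longrightarrow> bv \<alpha> \<subseteq> B i"
  by (induction i) (auto simp: msgs_Suc B_Suc(1) Suc_le_eq, simp add: msgs_def)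

lemma K_msgs:
  "i \<le> length \<xi> \<Longrightarrow> a \<in> agents Sg \<Longrightarrow> snd (K i a) \<subseteq> msgs i \<and>
     fst (K i a) = init a \<union> (\<Union>\<alpha>\<in>snd (K i a). pubs Sg \<alpha>)"
proof (induction i)
  case 0
  then show ?case by (simp add: K_0)
next
  case (Suc i)
  then have i: "i < length \<xi>" by simp
  consider "a = I" | "a = actor \<xi> (Suc i)" | "K (Suc i) a = K i a" using K_step(1)[OF i] Suc.prems by blast
  then show ?case using K_step(2,3)[OF i] Suc
    by cases (auto simp: update_def msgs_Suc split: prod.splits)
qed

text \<open>The assertion about to be sent is left out of the bound, so its derivation relies only
  on earlier assertions and on the one just received.\<close>

lemma K_actor:
  assumes "i < length \<xi>"
  shows "snd (K (Suc i) (actor \<xi> (Suc i))) \<subseteq> insert (recv \<xi> (Suc i)) (msgs i)"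
    and "recv \<xi> (Suc i) \<in> snd (K (Suc i) (actor \<xi> (Suc i)))"
  using K_step(2)[OF assms] K_msgs[of i "actor \<xi> (Suc i)"] action(1)[OF assms] assms
  by (auto simp: update_def split: prod.splits)

lemma K_intruder: "i < length \<xi> \<Longrightarrow> sent \<xi> (Suc i) \<in> snd (K (Suc i) I)"
  using K_step(3)[of i] by (auto simp: update_def split: prod.splits)

definition KT :: "nat \<Rightarrow> 'n \<Rightarrow> ('f, 'n, 'v) trm set" where
  "KT i a = fst (ksub \<sigma> (ker (K i a)))"

lemma KT_eq: "KT i a = app \<sigma> ` (fst (K i a) \<union> Var ` (\<Union>\<alpha>\<in>snd (K i a). bv \<alpha>))"
  by (simp add: KT_def ksub_def ker_def split: prod.splits)

lemma \<sigma>_Var: "x \<notin> act_fv \<xi> \<Longrightarrow> app \<sigma> (Var x) = Var x"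
  using dom_\<sigma> by (auto simp: app_Var split: option.splits)

lemma \<sigma>_vars: "vars (app \<sigma> t) \<subseteq> vars t"
  using ran_\<sigma> by (induction t) (auto simp: app_Var ran_def split: option.splits)

text \<open>Initial and public terms avoid quantified variables and \<open>\<sigma>\<close>
  introduces none, so these enter only through the binders added by the kernel.\<close>

lemma KT_vars:
  assumes "i \<le> length \<xi>" "a \<in> agents Sg"
  shows "(\<Union>s\<in>KT i a. vars s) \<subseteq> - Q \<union> (\<Union>\<alpha>\<in>snd (K i a). bv \<alpha>)"
proof -
  have "vars s \<subseteq> - Q" if "s \<in> fst (K i a)" for s
    using that K_msgs[OF assms] init_terms[OF assms(2)] pubs_vars by fast
  then show ?thesis unfolding KT_eq using \<sigma>_vars by fastforce
qed

lemma KT_wf: "i \<le> length \<xi> \<Longrightarrow> a \<in> agents Sg \<Longrightarrow> s \<in> KT i a \<Longrightarrow> wf_trm (ar Sg) s"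
proof -
  assume i: "i \<le> length \<xi>" "a \<in> agents Sg" and s: "s \<in> KT i a"
  have "ar Sg (pk Sg) = 1" using dy_system unfolding dy_system_def by blast
  then have "wf_trm (ar Sg) s" if "s \<in> fst (K i a)" for s
    using that K_msgs[OF i] init_terms[OF i(2)] pubs_wf msgs_wf[OF i(1)] by fast
  then show ?thesis using s ran_\<sigma> unfolding KT_eq by (auto intro!: wf_trm_app simp del: app_simps)
qed

lemma witness_vars:
  assumes "witness Sg \<sigma> (ker (K i a)) \<beta> Z \<nu>" "i \<le> length \<xi>" "a \<in> agents Sg"
  shows "dom \<nu> \<subseteq> bv \<beta>"
    and "\<nu> x = Some t \<Longrightarrow> vars t \<subseteq> - Q \<union> (\<Union>\<alpha>\<in>snd (K i a). bv \<alpha>)"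
proof -
  show "dom \<nu> \<subseteq> bv \<beta>" using assms(1) by (auto simp: witness_def)
  assume x: "\<nu> x = Some t"
  then have "dy Sg (KT i a) t" using assms(1) unfolding witness_def KT_def by force
  then show "vars t \<subseteq> - Q \<union> (\<Union>\<alpha>\<in>snd (K i a). bv \<alpha>)"
    using dy_vars[OF dy_system] KT_vars[OF assms(2,3)] by blast
qed

text \<open>The witness terms are derived from a kernel whose binders are earlier, and derivations
  add no variables. Together with \<open>\<theta>_props\<close> this makes the composition
  \<open>\<omega>\<close> triangular.\<close>

lemma \<mu>_props:
  assumes "i < length \<xi>"
  shows "dom (\<mu> (Suc i)) \<subseteq> bv (recv \<xi> (Suc i))" "\<mu> (Suc i) x = Some t \<Longrightarrow> vars t \<subseteq> - Q \<union> B i"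
proof -
  have w: "witness Sg \<sigma> (ker (K i I)) (recv \<xi> (Suc i)) (X (Suc i)) (\<mu> (Suc i))"
    using witness_recv[of "Suc i"] assms by simp
  show "dom (\<mu> (Suc i)) \<subseteq> bv (recv \<xi> (Suc i))"
    using witness_vars(1)[OF w] assms intruder_agent by simp
  have "(\<Union>\<alpha>\<in>snd (K i I). bv \<alpha>) \<subseteq> B i"
    using K_msgs[of i I] msgs_B[of i] assms intruder_agent by fastforce
  then show "\<mu> (Suc i) x = Some t \<Longrightarrow> vars t \<subseteq> - Q \<union> B i"
    using witness_vars(2)[OF w, of x t] assms intruder_agent by fastforce
qed

lemma \<theta>_props:
  assumes "i < length \<xi>"
  shows "dom (\<theta> (Suc i)) \<subseteq> bv (sent \<xi> (Suc i))"
    "\<theta> (Suc i) x = Some t \<Longrightarrow> vars t \<subseteq> - Q \<union> B i \<union> bv (recv \<xi> (Suc i))"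
proof -
  let ?a = "actor \<xi> (Suc i)"
  have w: "witness Sg \<sigma> (ker (K (Suc i) ?a)) (sent \<xi> (Suc i)) (Y (Suc i)) (\<theta> (Suc i))"
    using witness_sent[of "Suc i"] assms by simp
  have a: "?a \<in> agents Sg" "Suc i \<le> length \<xi>" using action(1)[OF assms] assms by simp_all
  show "dom (\<theta> (Suc i)) \<subseteq> bv (sent \<xi> (Suc i))" using witness_vars(1)[OF w a(2,1)] .
  have "(\<Union>\<alpha>\<in>snd (K (Suc i) ?a). bv \<alpha>) \<subseteq> B i \<union> bv (recv \<xi> (Suc i))"
    using K_actor(1)[OF assms] msgs_B[of i] assms by fastforce
  then show "\<theta> (Suc i) x = Some t \<Longrightarrow> vars t \<subseteq> - Q \<union> B i \<union> bv (recv \<xi> (Suc i))"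
    using witness_vars(2)[OF w a(2,1), of x t] by blast
qed

section \<open>The substitution \<omega> and what it absorbs\<close>

lemma \<omega>_Suc: "\<omega> (Suc i) t = \<omega> i (app (\<mu> (Suc i)) (app (\<theta> (Suc i)) t))"
  by (simp add: app_scomp)

declare omega.simps(2) [simp del]

text \<open>Later \<open>\<mu>\<close> and \<open>\<theta>\<close> act only on variables bound
  later, so an unquantified or already bound variable has its final value.\<close>

lemma \<omega>_stable:
  "j \<le> i \<Longrightarrow> i \<le> length \<xi> \<Longrightarrow> x \<in> - Q \<union> B j \<Longrightarrow> x \<in> - Q \<union> B i \<and> \<omega> i (Var x) = \<omega> j (Var x)"
proof (induction i rule: dec_induct)
  case (step i)
  then have i: "i < length \<xi>" and IH: "x \<in> - Q \<union> B i" "\<omega> i (Var x) = \<omega> j (Var x)" by auto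
  have "bv (recv \<xi> (Suc i)) \<subseteq> Q" "bv (sent \<xi> (Suc i)) \<subseteq> Q" using action[OF i] wf_asrt_bv by blast+
  then have "x \<notin> dom (\<mu> (Suc i))" "x \<notin> dom (\<theta> (Suc i))"
    using IH(1) B_Suc[OF i] \<mu>_props(1)[OF i] \<theta>_props(1)[OF i] by blast+
  then show ?case using IH B_Suc(1)[OF i] by (auto simp: \<omega>_Suc app_not_dom)
qed auto

abbreviation W :: "('f, 'n, 'v) trm \<Rightarrow> ('f, 'n, 'v) trm" where
  "W \<equiv> \<omega> (length \<xi>)"

lemma W_stable: "j \<le> length \<xi> \<Longrightarrow> vars t \<subseteq> - Q \<union> B j \<Longrightarrow> W t = \<omega> j t"
  by (rule app_cong) (use \<omega>_stable[of j "length \<xi>"] in blast)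

lemma W_free: "x \<notin> Q \<Longrightarrow> W (Var x) = app \<sigma> (Var x)"
  using W_stable[of 0 "Var x"] by simp

lemma \<omega>_fresh: "i \<le> length \<xi> \<Longrightarrow> x \<in> Q - B i \<Longrightarrow> \<omega> i (Var x) = Var x"
proof (induction i)
  case 0
  then show ?case using \<sigma>_Var act_fv_Q by auto
next
  case (Suc i)
  then have i: "i < length \<xi>" by simp
  then have "x \<notin> dom (\<mu> (Suc i))" "x \<notin> dom (\<theta> (Suc i))" "x \<in> Q - B i"
    using Suc.prems B_Suc(1)[OF i] \<mu>_props(1)[OF i] \<theta>_props(1)[OF i] by auto
  then show ?case using Suc by (simp add: \<omega>_Suc app_not_dom)
qed

text \<open>A variable in the domain is untouched by the \<open>\<theta>\<close> of the same action,
  and the quantified variables of its image were bound earlier; hence both sides can be evaluated at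
  stages where \<open>\<omega>\<close> is final.\<close>

lemma W_\<mu>:
  assumes i: "i < length \<xi>"
  shows "W (app (\<mu> (Suc i)) t) = W t"
proof (rule app_absorb)
  fix x
  show "W (app (\<mu> (Suc i)) (Var x)) = W (Var x)"
  proof (cases "\<mu> (Suc i) x")
    case (Some t)
    have x: "x \<in> bv (recv \<xi> (Suc i))" using \<mu>_props(1)[OF i] Some by blast
    then have x\<theta>: "x \<notin> dom (\<theta> (Suc i))" and "x \<in> B (Suc i)"
      using B_Suc(1,4)[OF i] \<theta>_props(1)[OF i] by blast+
    have \<mu>x: "app (\<mu> (Suc i)) (Var x) = t" using Some by (simp add: app_Var)
    have "W (Var x) = \<omega> (Suc i) (Var x)" using i \<open>x \<in> B (Suc i)\<close> by (intro W_stable) auto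
    also have "\<dots> = \<omega> i t" by (simp only: \<omega>_Suc app_not_dom[OF x\<theta>] \<mu>x)
    also have "\<dots> = W t" using i \<mu>_props(2)[OF i Some] W_stable[of i t] by simp
    finally show ?thesis by (simp only: \<mu>x)
  qed (simp add: app_Var)
qed

lemma W_\<theta>:
  assumes i: "i < length \<xi>"
  shows "W (app (\<theta> (Suc i)) t) = W t"
proof (rule app_absorb)
  fix x
  show "W (app (\<theta> (Suc i)) (Var x)) = W (Var x)"
  proof (cases "\<theta> (Suc i) x")
    case (Some t)
    have \<theta>x: "app (\<theta> (Suc i)) (Var x) = t" using Some by (simp add: app_Var)
    have "x \<in> B (Suc i)" using \<theta>_props(1)[OF i] Some B_Suc(1)[OF i] by blast
    then have "W (Var x) = \<omega> (Suc i) (Var x)" using i by (intro W_stable) auto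
    then have x: "W (Var x) = \<omega> i (app (\<mu> (Suc i)) t)" by (simp only: \<omega>_Suc \<theta>x)
    have t: "vars t \<subseteq> - Q \<union> B i \<union> bv (recv \<xi> (Suc i))" using \<theta>_props(2)[OF i Some] .
    have "bv (sent \<xi> (Suc i)) \<subseteq> Q" using action[OF i] wf_asrt_bv by blast
    \<comment> \<open>The image may contain binders of the received assertion but none of the sent
      one, so applying \<open>\<theta>\<close> again changes nothing.\<close>
    then have "y \<notin> dom (\<theta> (Suc i))" if "y \<in> vars t" for y
      using that t B_Suc(3,4)[OF i] \<theta>_props(1)[OF i] by blast
    then have \<theta>t: "app (\<theta> (Suc i)) t = t" by (intro app_id[OF app_not_dom])
    have "W t = \<omega> (Suc i) t" using t i B_Suc(1)[OF i] by (intro W_stable) auto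
    also have "\<dots> = \<omega> i (app (\<mu> (Suc i)) t)" by (simp only: \<omega>_Suc \<theta>t)
    finally show ?thesis by (simp only: x \<theta>x)
  qed (simp add: app_Var)
qed

lemma W_\<sigma>: "W (app \<sigma> t) = W t"
proof (rule app_absorb)
  fix x
  show "W (app \<sigma> (Var x)) = W (Var x)"
  proof (cases "\<sigma> x")
    case (Some t)
    then have "vars t = {}" "x \<notin> Q" using ran_\<sigma> dom_\<sigma> act_fv_Q by (auto simp: ran_def)
    then have "W t = t" "W (Var x) = app \<sigma> (Var x)" using W_free app_id[of t] by auto
    then show ?thesis using Some by (simp add: app_Var)
  qed (simp add: app_Var)
qed

text \<open>Each factor of the composition is absorbed; at the final index this says that
  \<open>\<omega>\<close> is idempotent.\<close>

lemma W_\<omega>: "i \<le> length \<xi> \<Longrightarrow> W (\<omega> i t) = W t"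
proof (induction i arbitrary: t)
  case 0
  then show ?case using W_\<sigma> by simp
next
  case (Suc i)
  then show ?case using W_\<mu>[of i] W_\<theta>[of i] by (simp add: \<omega>_Suc)
qed

text \<open>A received assertion is derived by the intruder from earlier ones, a sent one by the
  actor from earlier ones and the one just received; in this order the kernel behind each witness
  already holds.\<close>

lemma msgs_holds: "i \<le> length \<xi> \<Longrightarrow> \<alpha> \<in> msgs i \<Longrightarrow> \<gamma> \<in> atoms \<alpha> \<Longrightarrow> holds (omega \<sigma> \<mu> \<theta> (length \<xi>)) \<gamma>"
proof (induction i arbitrary: \<alpha> \<gamma>)
  case 0
  then show ?case by (simp add: msgs_def)
next
  case (Suc i)
  then have i: "i < length \<xi>" by simp
  have IH: "holds (omega \<sigma> \<mu> \<theta> (length \<xi>)) \<gamma>" if "\<alpha> \<in> msgs i" "\<gamma> \<in> atoms \<alpha>" for \<alpha> \<gamma>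
    using Suc.IH that i by simp
  have recv: "holds (omega \<sigma> \<mu> \<theta> (length \<xi>)) \<gamma>" if \<gamma>: "\<gamma> \<in> atoms (recv \<xi> (Suc i))" for \<gamma>
  proof (rule witness_holds[OF _ _ W_\<sigma> W_\<mu>[OF i] \<gamma>])
    show "witness Sg \<sigma> (ker (K i I)) (recv \<xi> (Suc i)) (X (Suc i)) (\<mu> (Suc i))"
      using witness_recv[of "Suc i"] i by simp
  qed (use K_msgs[of i I] intruder_agent i IH in auto)
  have sent: "holds (omega \<sigma> \<mu> \<theta> (length \<xi>)) \<gamma>" if \<gamma>: "\<gamma> \<in> atoms (sent \<xi> (Suc i))" for \<gamma>
  proof (rule witness_holds[OF _ _ W_\<sigma> W_\<theta>[OF i] \<gamma>])
    show "witness Sg \<sigma> (ker (K (Suc i) (actor \<xi> (Suc i)))) (sent \<xi> (Suc i)) (Y (Suc i)) (\<theta> (Suc i))"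
      using witness_sent[of "Suc i"] i by simp
  qed (use K_actor(1)[OF i] IH recv in auto)
  show ?case using Suc.prems IH recv sent by (auto simp: msgs_Suc)
qed

section \<open>The run as a typed model\<close>

definition KA :: "nat \<Rightarrow> ('p, 'f, 'n, 'v) asrt set" where
  "KA i = snd (ksub \<sigma> (ker (K i I)))"

lemma KA_eq: "KA i = asub \<sigma> ` (\<Union>\<alpha>\<in>snd (K i I). atoms \<alpha>)"
  by (simp add: KA_def ksub_def ker_def split: prod.splits)

lemma eq_model:
  assumes i: "i \<le> length \<xi>"
  shows "eq_model Sg (KT i I) (KA i) (omega \<sigma> \<mu> \<theta> (length \<xi>))"
proof
  note K = K_msgs[OF i intruder_agent]
  show "dy_system Sg" by (rule dy_system)
  show "wf_trm (ar Sg) s" if "s \<in> KT i I" for s using KT_wf[OF i intruder_agent that] .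
  fix \<gamma> assume "\<gamma> \<in> KA i"
  then obtain \<alpha> \<delta> where \<alpha>: "\<alpha> \<in> snd (K i I)" "\<delta> \<in> atoms \<alpha>" "\<gamma> = asub \<sigma> \<delta>" by (auto simp: KA_eq)
  then have m: "\<alpha> \<in> msgs i" using K by blast
  have "app \<sigma> ` (pubs Sg \<alpha> \<union> Var ` bv \<alpha>) \<subseteq> KT i I" using \<alpha>(1) K unfolding KT_eq by blast
  then show "terms_dy Sg (KT i I) \<gamma>"
    using dy_app_atoms[OF _ \<alpha>(2)] msgs_wf[OF i m] \<alpha>(3) by blast
  show "holds (omega \<sigma> \<mu> \<theta> (length \<xi>)) \<gamma>"
    using msgs_holds[OF i m \<alpha>(2)] \<alpha>(3) holds_asub W_\<sigma> by blast
qed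

abbreviation C :: "('f, 'n, 'v) trm set" where "C \<equiv> run_terms Sg \<xi> K"

abbreviation Ty :: "('f, 'n, 'v) trm set" where
  "Ty \<equiv> typed_terms Sg \<xi> K \<sigma> (omega \<sigma> \<mu> \<theta> (length \<xi>))"

lemma C_intruder: "i \<le> length \<xi> \<Longrightarrow> t \<in> know_st Sg (ker (K i I)) \<Longrightarrow> t \<in> C"
  by (auto simp: run_terms_def)

lemma C_actor: "i < length \<xi> \<Longrightarrow> t \<in> know_st Sg (ker (K (Suc i) (actor \<xi> (Suc i)))) \<Longrightarrow> t \<in> C"
  by (force simp: run_terms_def)

lemma bv_know_st: "\<alpha> \<in> snd k \<Longrightarrow> x \<in> bv \<alpha> \<Longrightarrow> Var x \<in> know_st Sg (ker k)"
  by (force simp: know_st_def ker_def split: prod.splits)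

lemma atoms_know_st: "\<alpha> \<in> snd k \<Longrightarrow> \<gamma> \<in> atoms \<alpha> \<Longrightarrow> ast Sg \<gamma> \<subseteq> know_st Sg (ker k)"
  by (force simp: know_st_def ker_def split: prod.splits)

text \<open>Kernels contain bound variables: those of a received assertion enter the kernel of the
  actor, those of a sent one the kernel of the intruder.\<close>

lemma B_C: "i \<le> length \<xi> \<Longrightarrow> x \<in> B i \<Longrightarrow> Var x \<in> C"
proof (induction i)
  case 0
  then show ?case by (simp add: B_0)
next
  case (Suc i)
  then have i: "i < length \<xi>" by simp
  consider "x \<in> B i" | "x \<in> bv (recv \<xi> (Suc i))" | "x \<in> bv (sent \<xi> (Suc i))"
    using Suc.prems B_Suc(1)[OF i] by blast
  then show ?case
  proof cases
    case 1
    then show ?thesis using Suc.IH i by simp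
  next
    case 2
    then show ?thesis using C_actor[OF i bv_know_st[OF K_actor(2)[OF i]]] by blast
  next
    case 3
    then show ?thesis using C_intruder[of "Suc i", OF _ bv_know_st[OF K_intruder[OF i]]] i by simp
  qed
qed

text \<open>Only variables need an argument: a quantified one is left alone by
  \<open>\<sigma>\<close> and is itself typed; on any other one \<open>\<sigma>\<close> and
  \<open>\<omega>\<close> agree.\<close>

lemma \<sigma>_C: "t \<in> C \<Longrightarrow> app \<sigma> t \<in> Ty"
proof (cases "\<exists>x. t = Var x")
  case True
  assume t: "t \<in> C"
  obtain x where x: "t = Var x" using True by blast
  show ?thesis
  proof (cases "x \<in> Q")
    case True
    then have "app \<sigma> t = Var x" using \<sigma>_Var[of x] act_fv_Q x by blast
    then show ?thesis using True by (auto simp: typed_terms_def)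
  next
    case False
    then have "app \<sigma> t = W t" using W_free x by simp
    then show ?thesis using t by (auto simp: typed_terms_def)
  qed
qed (auto simp: typed_terms_def)

lemma typed_model:
  assumes i: "i \<le> length \<xi>"
  shows "typed_model Sg (KT i I) (KA i) (omega \<sigma> \<mu> \<theta> (length \<xi>)) C Q \<sigma> Ty"
proof (intro typed_model.intro typed_model_axioms.intro)
  show "eq_model Sg (KT i I) (KA i) (omega \<sigma> \<mu> \<theta> (length \<xi>))" by (rule eq_model[OF i])
  show "Ty = app \<sigma> ` (C - range Var) \<union> W ` C \<union> Var ` Q" by (simp add: typed_terms_def)
  show "t \<in> C" if "Fun f ts \<in> C" "t \<in> set ts" for f ts t
    using that(1) know_st_args[OF _ that(2), of f Sg] unfolding run_terms_def by blast
  show "app \<sigma> t \<in> Ty" if "t \<in> C" for t using \<sigma>_C[OF that] .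
  show "W (app \<sigma> t) = W t" for t by (rule W_\<sigma>)
  show "W (W t) = W t" for t by (rule W_\<omega>) simp
  \<comment> \<open>A quantified variable is either bound in the run, hence a kernel term, or left
    alone by \<open>\<omega>\<close>.\<close>
  show "W (Var x) = Var x \<or> Var x \<in> C" if "x \<in> Q" for x
    using \<omega>_fresh[of "length \<xi>" x] B_C[of "length \<xi>" x] that by blast
  have *: "app \<sigma> t \<in> Ty" if "\<alpha> \<in> snd (K i I)" "\<gamma> \<in> atoms \<alpha>" "t \<in> ast Sg \<gamma>" for \<alpha> \<gamma> t
    using \<sigma>_C C_intruder[OF i] atoms_know_st[OF that(1,2)] that(3) by blast
  show "t \<in> Ty \<and> u \<in> Ty" if tu: "AEq t u \<in> KA i" for t u
  proof -
    obtain \<alpha> \<gamma> where g: "\<alpha> \<in> snd (K i I)" "\<gamma> \<in> atoms \<alpha>" "AEq t u = asub \<sigma> \<gamma>"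
      using tu by (auto simp: KA_eq)
    then obtain t' u' where "\<gamma> = AEq t' u'" by (cases \<gamma>) auto
    then show ?thesis using *[OF g(1,2)] g(3) by (simp add: st_refl)
  qed
  show "t \<in> Ty" if tl: "AMem t l \<in> KA i" for t l
  proof -
    obtain \<alpha> \<gamma> where g: "\<alpha> \<in> snd (K i I)" "\<gamma> \<in> atoms \<alpha>" "AMem t l = asub \<sigma> \<gamma>"
      using tl by (auto simp: KA_eq)
    then obtain t' where "\<gamma> = AMem t' l" by (cases \<gamma>) auto
    then show ?thesis using *[OF g(1,2)] g(3) by (simp add: st_refl)
  qed
qed

end

theorem theorem4:
  fixes Sg :: "('f, 'n, 'v) sys"
    and Pr :: "('p, 'f, 'n, 'v) role set"
    and init :: "'n \<Rightarrow> ('f, 'n, 'v) trm set"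
    and \<xi> :: "('p, 'f, 'n, 'v) action list"
    and \<sigma> :: "('f, 'n, 'v) sub"
    and K :: "nat \<Rightarrow> 'n \<Rightarrow> ('p, 'f, 'n, 'v) know"
    and X Y :: "nat \<Rightarrow> ('p, 'f, 'n, 'v) asrt set"
    and \<mu> \<theta> :: "nat \<Rightarrow> ('f, 'n, 'v) sub"
    and i :: nat and a b :: "('f, 'n, 'v) trm"
  assumes "dy_system Sg"
    and "protocol Sg Pr"
    and "run Sg Pr init \<xi> \<sigma> K"
    and "\<And>j. 1 \<le> j \<Longrightarrow> j \<le> length \<xi> \<Longrightarrow>
           witness Sg \<sigma> (ker (K (j - 1) (intruder Sg))) (recv \<xi> j) (X j) (\<mu> j)"
    and "\<And>j. 1 \<le> j \<Longrightarrow> j \<le> length \<xi> \<Longrightarrow>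
           witness Sg \<sigma> (ker (K j (actor \<xi> j))) (sent \<xi> j) (Y j) (\<theta> j)"
    and "i \<le> length \<xi>"
    and "eq_deriv Sg (ksub \<sigma> (ker (K i (intruder Sg)))) (AEq a b)"
  shows "\<exists>\<pi>. eq_proof Sg (ksub \<sigma> (ker (K i (intruder Sg)))) (AEq a b) \<pi> \<and> normal \<pi> \<and>
           typed_proof (typed_terms Sg \<xi> K \<sigma> (omega \<sigma> \<mu> \<theta> (length \<xi>))) \<pi>"
proof -
  interpret run_setting Sg Pr init \<xi> \<sigma> K X Y \<mu> \<theta>
    using assms(1,3-5) by unfold_locales auto
  interpret M: typed_model Sg "KT i (intruder Sg)" "KA i" "omega \<sigma> \<mu> \<theta> (length \<xi>)"
    "run_terms Sg \<xi> K" "qvars Sg" \<sigma> "typed_terms Sg \<xi> K \<sigma> (omega \<sigma> \<mu> \<theta> (length \<xi>))"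
    by (rule typed_model[OF assms(6)])
  have k: "ksub \<sigma> (ker (K i (intruder Sg))) = (KT i (intruder Sg), KA i)"
    by (simp add: KT_def KA_def)
  show ?thesis unfolding k by (rule M.typed_normal_proof[OF assms(7)[unfolded k]])
qed

end
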